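(* Let $\phi\colon[0,\infty)\to S^2$ be continuous and injective, and suppose that $(\sigma^t\phi)_{t\ge0}$ accumulates on $\phi$ in the compact-open topology on $C([0,\infty),S^2)$ as $t\to\infty$ (i.e. there exist $t_n\to\infty$ with $\sigma^{t_n}\phi\to\phi$ uniformly on compact sets). Then for every $\delta>0$ and every $T\ge0$ there exist distinct points $x_1,x_2\in S^2$ with $x_1=\phi(T)$ such that for every $\varepsilon>0$ there are intervals $[t_1,t_2],[t_3,t_4]\subseteq[0,\infty)$ with $$d(\phi(t_1),x_1)<\varepsilon,\quad d(\phi(t_2),x_2)<\varepsilon,\quad d(\phi(t_3),x_2)<\varepsilon,\quad d(\phi(t_4),x_1)<\varepsilon,$$ and $$\max_{t\in[t_1,t_2]\cup[t_3,t_4]} d(\phi(t),x_1)<\delta.$$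
   Context: $(\sigma^t\phi)(s)\coloneq\phi(t+s)$. $d$ denotes the angle (great-circle) metric on $S^2$. *)

theory Defs
  imports "HOL-Analysis.Analysis"
begin

definition S2 :: "(real^3) set" where
  "S2 = sphere 0 1"

definition sdist :: "real^3 \<Rightarrow> real^3 \<Rightarrow> real" where
  "sdist x y = arccos (x \<bullet> y)"

definition shift :: "real \<Rightarrow> (real \<Rightarrow> 'a) \<Rightarrow> real \<Rightarrow> 'a" where
  "shift t \<phi> = (\<lambda>s. \<phi> (t + s))"

end

theory Submission
  imports Defs "HOL-Complex_Analysis.Complex_Analysis"
begin

text \<open>
  An injective ray misses a point of the sphere (Baire), so stereographic projection moves the
  problem to the plane. Take \<open>x = \<phi>(T + \<beta>)\<close> and a limit \<open>e\<close> of the points where \<open>\<phi>\<close> last entered a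
  small disc before its returns to \<open>\<phi>(T)\<close>. If neither can serve as \<open>x\<^sub>2\<close>, then inside a disc \<open>D\<close>
  around \<open>p = \<phi>(T)\<close> (or rather a later return to it) the curve passes only from \<open>e\<close> to \<open>p\<close> and from \<open>p\<close> to \<open>x\<close>, never backwards. A
  return of \<open>\<phi>\<close> shadowing the strand \<open>e \<rightarrow> p \<rightarrow> x\<close> bounds with it a thin strip, cut into two halves by
  a short segment (the gate) near \<open>p\<close>. Choosing the strand nearest to \<open>p\<close> along the gate, we may
  assume that the gate does not meet the part of \<open>\<phi>\<close> between the two strands. Closing this part of
  \<open>\<phi>\<close> by a segment near \<open>e\<close>, near \<open>p\<close> or near \<open>x\<close> gives three loops whose winding numbers agree
  outside the strip, hence outside \<open>D\<close>. Since every passage through the gate has the same direction,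
  following \<open>\<phi>\<close> until its next passage, or until it returns close to \<open>e\<close> if there is none, shows that
  the first and the last loop have the same winding number around a point of the gate; but they
  differ by the winding number of the boundary of the strip, which is \<open>\<plusminus>1\<close> there.
\<close>

subsection \<open>Plane topology\<close>

lemma disjoint_between:
  "\<lbrakk>q \<notin> A; p \<notin> C; C \<subseteq> B; A \<inter> B \<subseteq> {p, q}\<rbrakk> \<Longrightarrow> A \<inter> C = {}"
  by blast

lemma disjoint_mono: "\<lbrakk>A \<subseteq> B; C \<subseteq> E; B \<inter> E = {}\<rbrakk> \<Longrightarrow> A \<inter> C = {}"
  by blast

lemma disjoint_off_two_points: "\<lbrakk>L \<inter> B = {p, q}; C \<subseteq> B; p \<notin> C; q \<notin> C\<rbrakk> \<Longrightarrow> L \<inter> C = {}"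
  by fast

text \<open>Gives access to the Jordan curve theorem for two arcs with common ends. The boundaries
  of the strip and of its halves are always taken in this form.\<close>

lemma loop_of_two_arcs:
  fixes f g :: "real \<Rightarrow> complex"
  assumes "arc f" "arc g" "pathstart f = p" "pathstart g = p" "pathfinish f = q" "pathfinish g = q"
    and "path_image f \<inter> path_image g = {p, q}"
  shows "simple_path (f +++ reversepath g)"
    and "pathfinish (f +++ reversepath g) = pathstart (f +++ reversepath g)"
    and "path_image (f +++ reversepath g) = path_image f \<union> path_image g"
    and "z \<notin> path_image f \<union> path_image g \<Longrightarrow>
      winding_number (f +++ reversepath g) z = winding_number f z - winding_number g z"
  using assms
  by (auto simp: simple_path_join_loop_eq arc_reversepath path_image_join arc_imp_path
      winding_number_join winding_number_reversepath)

text \<open>If \<open>g3\<close> did not run inside, it would run outside. The inside of the loop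
  through \<open>g1\<close> and \<open>g3\<close> would then be disjoint from the insides of the
  other two loops, so around a point of it \<open>g1\<close>, \<open>g2\<close> and
  \<open>g3\<close> would all have the same winding number, although \<open>g1\<close> and
  \<open>g3\<close> must differ there by a number of modulus 1.\<close>

lemma theta_curve_inside:
  fixes g1 g2 g3 :: "real \<Rightarrow> complex"
  assumes arc: "arc g1" "arc g2" "arc g3"
    and start: "pathstart g1 = p" "pathstart g2 = p" "pathstart g3 = p"
    and finish: "pathfinish g1 = q" "pathfinish g2 = q" "pathfinish g3 = q"
    and int12: "path_image g1 \<inter> path_image g2 = {p, q}"
    and int13: "path_image g1 \<inter> path_image g3 = {p, q}"
    and int23: "path_image g2 \<inter> path_image g3 = {p, q}"
    and out1: "path_image g1 - {p, q} \<subseteq> outside (path_image g2 \<union> path_image g3)"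
    and out2: "path_image g2 - {p, q} \<subseteq> outside (path_image g1 \<union> path_image g3)"
  shows "path_image g3 - {p, q} \<subseteq> inside (path_image g1 \<union> path_image g2)"
proof (rule ccontr)
  define L where "L g h = g +++ reversepath h" for g h :: "real \<Rightarrow> complex"
  note L = loop_of_two_arcs[folded L_def]
  note L12 = L[OF arc(1,2) start(1,2) finish(1,2) int12]
  note L13 = L[OF arc(1,3) start(1,3) finish(1,3) int13]
  note L23 = L[OF arc(2,3) start(2,3) finish(2,3) int23]
  note J12 = Jordan_inside_outside[OF L12(1,2), unfolded L12(3)]
  note J13 = Jordan_inside_outside[OF L13(1,2), unfolded L13(3)]
  note J23 = Jordan_inside_outside[OF L23(1,2), unfolded L23(3)]
  have conn: "connected (path_image g3 - {p, q})"
    using connected_simple_path_endless[OF arc_imp_simple_path[OF arc(3)]] start finish by simp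
  assume neg: "\<not> ?thesis"
  have sub: "path_image g3 - {p, q} \<subseteq>
      inside (path_image g1 \<union> path_image g2) \<union> outside (path_image g1 \<union> path_image g2)"
    unfolding inside_Un_outside using int13 int23 by blast
  \<comment> \<open>Without its ends \<open>g3\<close> is connected and misses the loop of
    \<open>g1\<close> and \<open>g2\<close>, so it lies wholly on one side.\<close>
  have out3: "path_image g3 - {p, q} \<subseteq> outside (path_image g1 \<union> path_image g2)"
  proof (rule ccontr)
    assume "\<not> ?thesis"
    then have "inside (path_image g1 \<union> path_image g2) \<inter> (path_image g3 - {p, q}) \<noteq> {}"
      "outside (path_image g1 \<union> path_image g2) \<inter> (path_image g3 - {p, q}) \<noteq> {}"
      using sub neg by blast+
    moreover have "open (inside (path_image g1 \<union> path_image g2))"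
      "open (outside (path_image g1 \<union> path_image g2))"
      using J12 by simp_all
    ultimately show False
      using conn sub inside_Int_outside unfolding connected_def by blast
  qed
  \<comment> \<open>If the insides of two loops sharing \<open>g\<close> overlap and neither meets
    the frontier of the other, connectedness makes them equal. Equal insides have equal frontiers,
    which leaves \<open>h\<close> with nothing but its ends.\<close>
  have distinct: False
    if "inside (path_image g \<union> path_image h) \<inter> inside (path_image g \<union> path_image k) \<noteq> {}"
      "frontier (inside (path_image g \<union> path_image h)) = path_image g \<union> path_image h"
      "frontier (inside (path_image g \<union> path_image k)) = path_image g \<union> path_image k"
      "connected (inside (path_image g \<union> path_image h))"
      "connected (inside (path_image g \<union> path_image k))"
      "path_image h - {p, q} \<subseteq> outside (path_image g \<union> path_image k)"
      "path_image k - {p, q} \<subseteq> outside (path_image g \<union> path_image h)"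
      "path_image g \<inter> path_image h = {p, q}" "path_image h \<inter> path_image k = {p, q}"
      "arc h" "pathstart h = p" "pathfinish h = q" for g h k :: "real \<Rightarrow> complex"
  proof -
    let ?I = "inside (path_image g \<union> path_image h)"
    let ?J = "inside (path_image g \<union> path_image k)"
    have pq: "p \<in> path_image g" "q \<in> path_image g" using that(8) by auto
    have "?I \<inter> frontier ?J = {}"
      unfolding that(3) using that(7) pq inside_no_overlap[of "path_image g \<union> path_image h"]
        inside_Int_outside[of "path_image g \<union> path_image h"] by fast
    moreover have "?J \<inter> frontier ?I = {}"
      unfolding that(2) using that(6) pq inside_no_overlap[of "path_image g \<union> path_image k"]
        inside_Int_outside[of "path_image g \<union> path_image k"] by fast
    ultimately have "?I \<subseteq> ?J" "?J \<subseteq> ?I"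
      using connected_Int_frontier[OF that(4), of ?J] connected_Int_frontier[OF that(5), of ?I] that(1)
      by blast+
    then have "?I = ?J" by blast
    then have "path_image g \<union> path_image h = path_image g \<union> path_image k"
      using that(2,3) by metis
    then have "path_image h - {p, q} = {}" using that(8,9) by blast
    then show False
      using nonempty_simple_path_endless[OF arc_imp_simple_path[OF that(10)]] that(11,12) by simp
  qed
  have fr: "frontier (inside (path_image g1 \<union> path_image g2)) = path_image g1 \<union> path_image g2"
    "frontier (inside (path_image g1 \<union> path_image g3)) = path_image g1 \<union> path_image g3"
    "frontier (inside (path_image g2 \<union> path_image g3)) = path_image g2 \<union> path_image g3"
    using J12 J13 J23 by simp_all
  have cn: "connected (inside (path_image g1 \<union> path_image g2))"
    "connected (inside (path_image g1 \<union> path_image g3))"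
    "connected (inside (path_image g2 \<union> path_image g3))"
    using J12 J13 J23 by simp_all
  note U = Un_commute[of "path_image g3" "path_image g1"]
    Un_commute[of "path_image g3" "path_image g2"]
  have disj12: "inside (path_image g1 \<union> path_image g3) \<inter> inside (path_image g1 \<union> path_image g2) = {}"
    using distinct[OF _ fr(2,1) cn(2,1) out3 out2 int13 _ arc(3) start(3) finish(3)] int23 by blast
  have disj23: "inside (path_image g1 \<union> path_image g3) \<inter> inside (path_image g2 \<union> path_image g3) = {}"
    using distinct[of g3 g1 g2, unfolded U, OF _ fr(2,3) cn(2,3) out1 out2 _ int12 arc(1) start(1) finish(1)]
      int13 by blast
  \<comment> \<open>Around \<open>u\<close> the loops through \<open>g2\<close> have winding number
    zero, which chains \<open>g1\<close>, \<open>g2\<close> and \<open>g3\<close> together.\<close>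
  obtain u where u: "u \<in> inside (path_image g1 \<union> path_image g3)"
    using J13 by blast
  have un: "u \<notin> path_image g1" "u \<notin> path_image g3"
    using u inside_no_overlap[of "path_image g1 \<union> path_image g3"] by fast+
  have u2: "u \<notin> path_image g2"
  proof
    assume "u \<in> path_image g2"
    then have "u \<in> outside (path_image g1 \<union> path_image g3)"
      using out2 un int12 by blast
    then show False using u inside_Int_outside by blast
  qed
  have "u \<in> outside (path_image g1 \<union> path_image g2)"
    using disj12 u un u2 inside_Un_outside[of "path_image g1 \<union> path_image g2"] by fast
  then have "winding_number g1 u = winding_number g2 u"
    using winding_number_zero_in_outside[of "L g1 g2" u] simple_path_imp_path[OF L12(1)] L12 un u2 by simp
  moreover have "u \<in> outside (path_image g2 \<union> path_image g3)"
    using disj23 u un u2 inside_Un_outside[of "path_image g2 \<union> path_image g3"] by fast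
  then have "winding_number g2 u = winding_number g3 u"
    using winding_number_zero_in_outside[of "L g2 g3" u] simple_path_imp_path[OF L23(1)] L23 un u2 by simp
  moreover have "cmod (winding_number (L g1 g3) u) = 1"
    using simple_closed_path_norm_winding_number_inside[OF L13(1)] u L13(3) by simp
  ultimately show False using L13(4) un by simp
qed

lemma subpath_path:
  fixes \<phi> :: "real \<Rightarrow> 'a::real_normed_vector"
  assumes "continuous_on {0..} \<phi>" "0 \<le> u" "0 \<le> v"
  shows "path (subpath u v \<phi>)"
proof -
  have "continuous_on (closed_segment u v) \<phi>"
    using assms by (auto intro!: continuous_on_subset[OF assms(1)] simp: closed_segment_eq_real_ivl)
  then show ?thesis
    unfolding path_def subpath_def
    by (rule continuous_on_compose2) (auto intro!: continuous_intros simp: closed_segment_real_eq)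
qed

lemma subpath_arc:
  fixes \<phi> :: "real \<Rightarrow> 'a::real_normed_vector"
  assumes "continuous_on {0..} \<phi>" "inj_on \<phi> {0..}" "0 \<le> u" "0 \<le> v" "u \<noteq> v"
  shows "arc (subpath u v \<phi>)"
proof -
  have *: "(v - u) * x + u \<ge> 0" if "x \<in> {0..1}" for x
  proof -
    have "(v - u) * x + u = (1 - x) * u + x * v" by (simp add: algebra_simps)
    then show ?thesis using that assms by simp
  qed
  have "inj_on (subpath u v \<phi>) {0..1}"
  proof (rule inj_onI)
    fix x y assume "x \<in> {0..1}" "y \<in> {0..1}" "subpath u v \<phi> x = subpath u v \<phi> y"
    then have "(v - u) * x + u = (v - u) * y + u"
      using inj_onD[OF assms(2), of "(v - u) * x + u" "(v - u) * y + u"] *[of x] *[of y]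
      unfolding subpath_def by simp
    then show "x = y" using assms(5) by simp
  qed
  then show ?thesis using subpath_path assms by (simp add: arc_def)
qed

text \<open>The interval from \<open>u\<close> to \<open>w\<close> is rescaled to the unit interval,
  where \<open>v\<close> becomes the ratio \<open>?r\<close>. The rescaling degenerates for
  \<open>u = w\<close>, hence the case distinction.\<close>

lemma winding_number_subpath_split:
  fixes \<phi> :: "real \<Rightarrow> complex"
  assumes "continuous_on {0..} \<phi>" "0 \<le> u" "u \<le> v" "v \<le> w" "z \<notin> \<phi> ` {u..w}"
  shows "winding_number (subpath u w \<phi>) z
       = winding_number (subpath u v \<phi>) z + winding_number (subpath v w \<phi>) z"
proof -
  have im: "z \<notin> path_image (subpath s t \<phi>)" if "s \<in> {u..w}" "t \<in> {u..w}" for s t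
    using assms(5) that by (auto simp: path_image_subpath_gen closed_segment_eq_real_ivl)
  show ?thesis
  proof (cases "u = w")
    case True
    then have "v = u" using assms by simp
    moreover have "winding_number (subpath u u \<phi>) z = 0"
      using im[of u u] True
      by (metis atLeastAtMost_iff order_refl path_image_subpath_gen singletonI subpath_refl
          winding_number_trivial closed_segment_idem image_insert image_is_empty image_empty)
    ultimately show ?thesis using True by simp
  next
    case False
    let ?r = "(v - u) / (w - u)"
    have r: "?r \<in> {0..1}" using assms False by (auto simp: divide_simps)
    have 1: "subpath 0 1 (subpath u w \<phi>) = subpath u w \<phi>" by simp
    have 2: "subpath 0 ?r (subpath u w \<phi>) = subpath u v \<phi>"
    proof -
      have "(w - u) * ?r = v - u" using False by simp
      then have "(w - u) * (?r * x) = (v - u) * x" for x by (simp only: mult.assoc[symmetric])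
      then show ?thesis by (simp add: subpath_def)
    qed
    have 3: "subpath ?r 1 (subpath u w \<phi>) = subpath v w \<phi>"
    proof -
      have "(w - u) * ((1 - ?r) * x + ?r) + u = (w - v) * x + v" for x
      proof -
        have "(w - u) * ?r = v - u" using False by simp
        moreover have "(w - u) * ((1 - ?r) * x + ?r) + u = ((w - u) - (w - u) * ?r) * x + (w - u) * ?r + u"
          by (simp only: algebra_simps)
        ultimately show ?thesis by simp
      qed
      then show ?thesis by (simp add: subpath_def)
    qed
    show ?thesis
      using winding_number_subpath_combine[of "subpath u w \<phi>" z 0 ?r 1, unfolded 1 2 3] r
        subpath_path[OF assms(1)] assms im by auto
  qed
qed

subsection \<open>The strip between two strands\<close>

text \<open>Two strands of the curve, the second one later in time, are joined by straight segments
  at their first ends (near e), in the middle (near p) and at their last ends (near x).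
  \<open>out1\<close> and \<open>out2\<close> prevent one half of the strip from enclosing the
  other; one witness point per half is enough by connectedness. Convexity of \<open>D\<close> keeps
  the segments in \<open>D\<close> and puts every point off \<open>D\<close> outside all curves
  within \<open>D\<close>.\<close>

locale strip =
  fixes \<phi> :: "real \<Rightarrow> complex" and a1 a a2 b1 b b2 :: real and D :: "complex set"
  assumes cont: "continuous_on {0..} \<phi>" and inj: "inj_on \<phi> {0..}"
    and order: "0 \<le> a1" "a1 < a" "a < a2" "a2 < b1" "b1 < b" "b < b2"
    and open_D: "open D" and D: "convex D" "\<phi> ` {a1..a2} \<subseteq> D" "\<phi> ` {b1..b2} \<subseteq> D"
    and seg1: "closed_segment (\<phi> a1) (\<phi> b1) \<inter> (\<phi> ` {a1..a2} \<union> \<phi> ` {b1..b2}) = {\<phi> a1, \<phi> b1}"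
    and segm: "closed_segment (\<phi> a) (\<phi> b) \<inter> (\<phi> ` {a1..a2} \<union> \<phi> ` {b1..b2}) = {\<phi> a, \<phi> b}"
    and seg2: "closed_segment (\<phi> a2) (\<phi> b2) \<inter> (\<phi> ` {a1..a2} \<union> \<phi> ` {b1..b2}) = {\<phi> a2, \<phi> b2}"
    and seg_disj: "closed_segment (\<phi> a1) (\<phi> b1) \<inter> closed_segment (\<phi> a) (\<phi> b) = {}"
      "closed_segment (\<phi> a1) (\<phi> b1) \<inter> closed_segment (\<phi> a2) (\<phi> b2) = {}"
      "closed_segment (\<phi> a) (\<phi> b) \<inter> closed_segment (\<phi> a2) (\<phi> b2) = {}"
    and out1: "\<phi> a1 \<in> outside (\<phi> ` {a..a2} \<union> closed_segment (\<phi> a2) (\<phi> b2) \<union> \<phi> ` {b..b2}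
                 \<union> closed_segment (\<phi> a) (\<phi> b))"
    and out2: "\<phi> b2 \<in> outside (\<phi> ` {a1..a} \<union> closed_segment (\<phi> a1) (\<phi> b1) \<union> \<phi> ` {b1..b}
                 \<union> closed_segment (\<phi> a) (\<phi> b))"
begin

abbreviation "gateE \<equiv> closed_segment (\<phi> a1) (\<phi> b1)"
abbreviation "gate \<equiv> closed_segment (\<phi> a) (\<phi> b)"
abbreviation "gateX \<equiv> closed_segment (\<phi> a2) (\<phi> b2)"

definition "halfE = \<phi> ` {a1..a} \<union> gateE \<union> \<phi> ` {b1..b}"
definition "halfX = \<phi> ` {a..a2} \<union> gateX \<union> \<phi> ` {b..b2}"
text \<open>Both arcs are oriented from \<open>\<phi> a\<close> to \<open>\<phi> b\<close>, so that
  with the gate they form a theta curve. Hence \<open>arcE\<close> runs backwards along the first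
  strand, and \<open>arcX\<close> backwards along the second.\<close>

definition "arcE = subpath a a1 \<phi> +++ linepath (\<phi> a1) (\<phi> b1) +++ subpath b1 b \<phi>"
definition "arcX = subpath a a2 \<phi> +++ linepath (\<phi> a2) (\<phi> b2) +++ subpath b2 b \<phi>"

lemma phi_eq: "\<phi> s = \<phi> t \<longleftrightarrow> s = t" if "0 \<le> s" "0 \<le> t"
  using inj_onD[OF inj] that by auto

lemma phi_in_seg:
  assumes "t \<in> {a1..a2} \<union> {b1..b2}"
  shows "\<phi> t \<in> gateE \<longleftrightarrow> t = a1 \<or> t = b1" "\<phi> t \<in> gate \<longleftrightarrow> t = a \<or> t = b"
    "\<phi> t \<in> gateX \<longleftrightarrow> t = a2 \<or> t = b2"
proof -
  have "\<phi> t \<in> \<phi> ` {a1..a2} \<union> \<phi> ` {b1..b2}" using assms by blast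
  then have *: "\<phi> t \<in> gateE \<longleftrightarrow> \<phi> t \<in> {\<phi> a1, \<phi> b1}" "\<phi> t \<in> gate \<longleftrightarrow> \<phi> t \<in> {\<phi> a, \<phi> b}"
    "\<phi> t \<in> gateX \<longleftrightarrow> \<phi> t \<in> {\<phi> a2, \<phi> b2}"
    using seg1 segm seg2 by blast+
  have "t \<ge> 0" using assms order by auto
  then show "\<phi> t \<in> gateE \<longleftrightarrow> t = a1 \<or> t = b1" "\<phi> t \<in> gate \<longleftrightarrow> t = a \<or> t = b"
    "\<phi> t \<in> gateX \<longleftrightarrow> t = a2 \<or> t = b2"
    unfolding * using order by (simp_all add: phi_eq)
qed

lemma ends_distinct: "\<phi> a1 \<noteq> \<phi> b1" "\<phi> a \<noteq> \<phi> b" "\<phi> a2 \<noteq> \<phi> b2"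
  using order by (simp_all add: phi_eq)

lemma arcE: "arc arcE" "path_image arcE = halfE" "pathstart arcE = \<phi> a" "pathfinish arcE = \<phi> b"
proof -
  have im: "path_image (subpath a a1 \<phi>) = \<phi> ` {a1..a}" "path_image (subpath b1 b \<phi>) = \<phi> ` {b1..b}"
    using order by (simp_all add: path_image_subpath_gen closed_segment_eq_real_ivl)
  have 1: "arc (subpath a a1 \<phi>)" "arc (subpath b1 b \<phi>)"
    by (rule subpath_arc[OF cont inj]; use order in simp)+
  have 2: "arc (linepath (\<phi> a1) (\<phi> b1) +++ subpath b1 b \<phi>)"
  proof (rule arc_join)
    show "path_image (linepath (\<phi> a1) (\<phi> b1)) \<inter> path_image (subpath b1 b \<phi>)
        \<subseteq> {pathstart (subpath b1 b \<phi>)}"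
      using order by (auto simp: im phi_in_seg)
  qed (use 1 ends_distinct in auto)
  show "arc arcE"
    unfolding arcE_def
  proof (rule arc_join[OF 1(1) 2])
    have "x = \<phi> a1" if "x \<in> \<phi> ` {a1..a}" "x \<in> gateE \<union> \<phi> ` {b1..b}" for x
      using that order by (auto simp: phi_in_seg phi_eq)
    then show "path_image (subpath a a1 \<phi>) \<inter> path_image (linepath (\<phi> a1) (\<phi> b1) +++ subpath b1 b \<phi>)
        \<subseteq> {pathstart (linepath (\<phi> a1) (\<phi> b1) +++ subpath b1 b \<phi>)}"
      by (auto simp: path_image_join im)
  qed simp
  show "path_image arcE = halfE" "pathstart arcE = \<phi> a" "pathfinish arcE = \<phi> b"
    by (auto simp: arcE_def halfE_def path_image_join im)
qed

lemma arcX: "arc arcX" "path_image arcX = halfX" "pathstart arcX = \<phi> a" "pathfinish arcX = \<phi> b"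
proof -
  have im: "path_image (subpath a a2 \<phi>) = \<phi> ` {a..a2}" "path_image (subpath b2 b \<phi>) = \<phi> ` {b..b2}"
    using order by (simp_all add: path_image_subpath_gen closed_segment_eq_real_ivl)
  have 1: "arc (subpath a a2 \<phi>)" "arc (subpath b2 b \<phi>)"
    by (rule subpath_arc[OF cont inj]; use order in simp)+
  have 2: "arc (linepath (\<phi> a2) (\<phi> b2) +++ subpath b2 b \<phi>)"
  proof (rule arc_join)
    show "path_image (linepath (\<phi> a2) (\<phi> b2)) \<inter> path_image (subpath b2 b \<phi>)
        \<subseteq> {pathstart (subpath b2 b \<phi>)}"
      using order by (auto simp: im phi_in_seg)
  qed (use 1 ends_distinct in auto)
  show "arc arcX"
    unfolding arcX_def
  proof (rule arc_join[OF 1(1) 2])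
    have "x = \<phi> a2" if "x \<in> \<phi> ` {a..a2}" "x \<in> gateX \<union> \<phi> ` {b..b2}" for x
      using that order by (auto simp: phi_in_seg phi_eq)
    then show "path_image (subpath a a2 \<phi>) \<inter> path_image (linepath (\<phi> a2) (\<phi> b2) +++ subpath b2 b \<phi>)
        \<subseteq> {pathstart (linepath (\<phi> a2) (\<phi> b2) +++ subpath b2 b \<phi>)}"
      by (auto simp: path_image_join im)
  qed simp
  show "path_image arcX = halfX" "pathstart arcX = \<phi> a" "pathfinish arcX = \<phi> b"
    by (auto simp: arcX_def halfX_def path_image_join im)
qed

lemma arcm: "arc (linepath (\<phi> a) (\<phi> b))"
  using ends_distinct by simp

lemma halves_Int: "halfE \<inter> halfX = {\<phi> a, \<phi> b}"
proof
  show "{\<phi> a, \<phi> b} \<subseteq> halfE \<inter> halfX" using order by (auto simp: halfE_def halfX_def)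
  have "x \<in> {\<phi> a, \<phi> b}" if "x \<in> halfE" "x \<in> halfX" for x
  proof -
    have "x \<notin> gateE \<or> x \<notin> gateX" using seg_disj by blast
    then show ?thesis using that order by (auto simp: halfE_def halfX_def phi_in_seg phi_eq)
  qed
  then show "halfE \<inter> halfX \<subseteq> {\<phi> a, \<phi> b}" by blast
qed

lemma halfE_Int_gate: "halfE \<inter> gate = {\<phi> a, \<phi> b}"
proof
  show "{\<phi> a, \<phi> b} \<subseteq> halfE \<inter> gate" using order by (auto simp: halfE_def)
  have "x \<in> {\<phi> a, \<phi> b}" if "x \<in> halfE" "x \<in> gate" for x
  proof -
    have "x \<notin> gateE" using seg_disj that by blast
    then show ?thesis using that order by (auto simp: halfE_def phi_in_seg phi_eq)
  qed
  then show "halfE \<inter> gate \<subseteq> {\<phi> a, \<phi> b}" by blast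
qed

lemma halfX_Int_gate: "halfX \<inter> gate = {\<phi> a, \<phi> b}"
proof
  show "{\<phi> a, \<phi> b} \<subseteq> halfX \<inter> gate" using order by (auto simp: halfX_def)
  have "x \<in> {\<phi> a, \<phi> b}" if "x \<in> halfX" "x \<in> gate" for x
  proof -
    have "x \<notin> gateX" using seg_disj that by blast
    then show ?thesis using that order by (auto simp: halfX_def phi_in_seg phi_eq)
  qed
  then show "halfX \<inter> gate \<subseteq> {\<phi> a, \<phi> b}" by blast
qed

text \<open>The witness \<open>\<phi> a1\<close> of \<open>out1\<close> lies on the open arc, which
  is connected and misses the other loop, so the whole open arc is outside with it.\<close>

lemma outE: "halfE - {\<phi> a, \<phi> b} \<subseteq> outside (halfX \<union> gate)"
proof
  fix x assume x: "x \<in> halfE - {\<phi> a, \<phi> b}"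
  have "connected (halfE - {\<phi> a, \<phi> b})"
    using connected_simple_path_endless[OF arc_imp_simple_path[OF arcE(1)]] arcE by simp
  moreover have "\<phi> a1 \<in> halfE - {\<phi> a, \<phi> b}" using order by (auto simp: halfE_def phi_eq)
  moreover have "halfE - {\<phi> a, \<phi> b} \<subseteq> - (halfX \<union> gate)" using halves_Int halfE_Int_gate by blast
  ultimately have "connected_component (- (halfX \<union> gate)) (\<phi> a1) x"
    using x unfolding connected_component_def by blast
  moreover have "\<phi> a1 \<in> outside (halfX \<union> gate)" using out1 by (simp add: halfX_def)
  ultimately show "x \<in> outside (halfX \<union> gate)" using outside_same_component by blast
qed

lemma outX: "halfX - {\<phi> a, \<phi> b} \<subseteq> outside (halfE \<union> gate)"
proof
  fix x assume x: "x \<in> halfX - {\<phi> a, \<phi> b}"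
  have "connected (halfX - {\<phi> a, \<phi> b})"
    using connected_simple_path_endless[OF arc_imp_simple_path[OF arcX(1)]] arcX by simp
  moreover have "\<phi> b2 \<in> halfX - {\<phi> a, \<phi> b}" using order by (auto simp: halfX_def phi_eq)
  moreover have "halfX - {\<phi> a, \<phi> b} \<subseteq> - (halfE \<union> gate)" using halves_Int halfX_Int_gate by blast
  ultimately have "connected_component (- (halfE \<union> gate)) (\<phi> b2) x"
    using x unfolding connected_component_def by blast
  moreover have "\<phi> b2 \<in> outside (halfE \<union> gate)" using out2 by (simp add: halfE_def)
  ultimately show "x \<in> outside (halfE \<union> gate)" using outside_same_component by blast
qed

lemma gate_inside: "gate - {\<phi> a, \<phi> b} \<subseteq> inside (halfE \<union> halfX)"
  using theta_curve_inside[OF arcE(1) arcX(1) arcm arcE(3) arcX(3) _ arcE(4) arcX(4)]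
  by (simp add: arcE(2) arcX(2) halves_Int halfE_Int_gate halfX_Int_gate outE outX)

section \<open>Winding numbers of the curve closed up by the three segments\<close>

definition "loop u v = subpath u v \<phi> +++ linepath (\<phi> v) (\<phi> u)"

lemma loop:
  assumes "0 \<le> u" "u \<le> v"
  shows "path (loop u v)" "pathfinish (loop u v) = pathstart (loop u v)"
    "path_image (loop u v) = \<phi> ` {u..v} \<union> closed_segment (\<phi> u) (\<phi> v)"
  using subpath_path[OF cont] assms
  by (auto simp: loop_def path_image_join path_image_subpath_gen closed_segment_eq_real_ivl
      closed_segment_commute)

lemma winding_loop:
  assumes "0 \<le> u" "u \<le> v" "z \<notin> \<phi> ` {u..v} \<union> closed_segment (\<phi> u) (\<phi> v)"
  shows "winding_number (loop u v) z
       = winding_number (subpath u v \<phi>) z - winding_number (linepath (\<phi> u) (\<phi> v)) z"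
proof -
  have "winding_number (linepath (\<phi> v) (\<phi> u)) z = - winding_number (linepath (\<phi> u) (\<phi> v)) z"
    using winding_number_reversepath[of "linepath (\<phi> u) (\<phi> v)" z] assms by simp
  then show ?thesis
    using assms subpath_path[OF cont, of u v]
    by (simp add: loop_def winding_number_join path_image_subpath_gen closed_segment_eq_real_ivl
        closed_segment_commute)
qed

text \<open>The transport rule for winding numbers. In its uses \<open>S\<close> is a piece of the
  curve, a piece of the gate or a small ball around \<open>\<phi> a1\<close>.\<close>

lemma winding_loop_eq:
  assumes "0 \<le> u" "u \<le> v" "connected S" "w \<in> S" "z \<in> S"
    "S \<inter> (\<phi> ` {u..v} \<union> closed_segment (\<phi> u) (\<phi> v)) = {}"
  shows "winding_number (loop u v) w = winding_number (loop u v) z"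
  using winding_number_eq[OF loop(1,2)[OF assms(1,2)] assms(4,5,3)] loop(3)[OF assms(1,2)] assms(6)
  by simp

lemma winding_arcE:
  assumes "z \<notin> halfE"
  shows "winding_number arcE z = - winding_number (subpath a1 a \<phi>) z
    + winding_number (linepath (\<phi> a1) (\<phi> b1)) z + winding_number (subpath b1 b \<phi>) z"
proof -
  have "winding_number (subpath a a1 \<phi>) z = - winding_number (subpath a1 a \<phi>) z"
    using winding_number_reversepath[of "subpath a1 a \<phi>" z] assms order subpath_path[OF cont, of a1 a]
    by (simp add: reversepath_subpath halfE_def path_image_subpath_gen closed_segment_eq_real_ivl)
  then show ?thesis
    using assms order subpath_path[OF cont]
    by (simp add: arcE_def winding_number_join halfE_def path_image_join
        path_image_subpath_gen closed_segment_eq_real_ivl)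
qed

lemma winding_arcX:
  assumes "z \<notin> halfX"
  shows "winding_number arcX z = winding_number (subpath a a2 \<phi>) z
    + winding_number (linepath (\<phi> a2) (\<phi> b2)) z - winding_number (subpath b b2 \<phi>) z"
proof -
  have "winding_number (subpath b2 b \<phi>) z = - winding_number (subpath b b2 \<phi>) z"
    using winding_number_reversepath[of "subpath b b2 \<phi>" z] assms order subpath_path[OF cont, of b b2]
    by (simp add: reversepath_subpath halfX_def path_image_subpath_gen closed_segment_eq_real_ivl)
  then show ?thesis
    using assms order subpath_path[OF cont]
    by (simp add: arcX_def winding_number_join halfX_def path_image_join
        path_image_subpath_gen closed_segment_eq_real_ivl)
qed

text \<open>Following \<open>f\<close> and returning along \<open>g\<close> gives a Jordan curve,
  whose winding number is 0 outside and of modulus 1 inside.\<close>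

lemma winding_closed:
  assumes "arc f" "arc g" "pathstart f = \<phi> a" "pathstart g = \<phi> a"
    "pathfinish f = \<phi> b" "pathfinish g = \<phi> b" "path_image f \<inter> path_image g = {\<phi> a, \<phi> b}"
    "z \<notin> path_image f \<union> path_image g"
  shows "z \<in> outside (path_image f \<union> path_image g) \<Longrightarrow> winding_number f z = winding_number g z"
    "z \<in> inside (path_image f \<union> path_image g) \<Longrightarrow> winding_number f z \<noteq> winding_number g z"
proof -
  note L = loop_of_two_arcs[OF assms(1-7)]
  show "winding_number f z = winding_number g z" if "z \<in> outside (path_image f \<union> path_image g)"
    using winding_number_zero_in_outside[OF simple_path_imp_path[OF L(1)] L(2)] that L(3) L(4)[OF assms(8)] by simp
  show "winding_number f z \<noteq> winding_number g z" if "z \<in> inside (path_image f \<union> path_image g)"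
    using simple_closed_path_norm_winding_number_inside[OF L(1)] that L(3) L(4)[OF assms(8)] by (metis diff_self norm_zero zero_neq_one)
qed

text \<open>The common part of the two loops cancels and leaves the boundary of the E half. This and
  the next two identities only ask \<open>z\<close> to avoid the curves they involve, so each can be
  evaluated at points lying on the remaining part of the strip.\<close>

lemma winding_E_m:
  assumes "z \<notin> \<phi> ` {a1..b} \<union> gateE \<union> gate"
  shows "winding_number (loop a1 b1) z - winding_number (loop a b) z
       = winding_number (linepath (\<phi> a) (\<phi> b)) z - winding_number arcE z"
proof -
  have n: "z \<notin> \<phi> ` A" if "A \<subseteq> {a1..b}" for A using assms that by blast
  have "winding_number (subpath a1 b \<phi>) z
      = winding_number (subpath a1 a \<phi>) z + winding_number (subpath a b \<phi>) z"
    "winding_number (subpath a1 b \<phi>) z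
      = winding_number (subpath a1 b1 \<phi>) z + winding_number (subpath b1 b \<phi>) z"
    by (rule winding_number_subpath_split[OF cont]; use order n in auto)+
  moreover have "z \<notin> halfE" using assms n[of "{a1..a}"] n[of "{b1..b}"] order by (auto simp: halfE_def)
  moreover have "winding_number (loop a1 b1) z
      = winding_number (subpath a1 b1 \<phi>) z - winding_number (linepath (\<phi> a1) (\<phi> b1)) z"
    "winding_number (loop a b) z
      = winding_number (subpath a b \<phi>) z - winding_number (linepath (\<phi> a) (\<phi> b)) z"
    by (rule winding_loop; use assms n[of "{a1..b1}"] n[of "{a..b}"] order in simp)+
  ultimately show ?thesis using winding_arcE[of z] by algebra
qed

lemma winding_m_X:
  assumes "z \<notin> \<phi> ` {a..b2} \<union> gateX \<union> gate"
  shows "winding_number (loop a b) z - winding_number (loop a2 b2) z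
       = winding_number arcX z - winding_number (linepath (\<phi> a) (\<phi> b)) z"
proof -
  have n: "z \<notin> \<phi> ` A" if "A \<subseteq> {a..b2}" for A using assms that by blast
  have "winding_number (subpath a b2 \<phi>) z
      = winding_number (subpath a a2 \<phi>) z + winding_number (subpath a2 b2 \<phi>) z"
    "winding_number (subpath a b2 \<phi>) z
      = winding_number (subpath a b \<phi>) z + winding_number (subpath b b2 \<phi>) z"
    by (rule winding_number_subpath_split[OF cont]; use order n in auto)+
  moreover have "z \<notin> halfX" using assms n[of "{a..a2}"] n[of "{b..b2}"] order by (auto simp: halfX_def)
  moreover have "winding_number (loop a2 b2) z
      = winding_number (subpath a2 b2 \<phi>) z - winding_number (linepath (\<phi> a2) (\<phi> b2)) z"
    "winding_number (loop a b) z
      = winding_number (subpath a b \<phi>) z - winding_number (linepath (\<phi> a) (\<phi> b)) z"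
    by (rule winding_loop; use assms n[of "{a2..b2}"] n[of "{a..b}"] order in simp)+
  ultimately show ?thesis using winding_arcX[of z] by algebra
qed

lemma winding_E_X:
  assumes "z \<notin> \<phi> ` {a1..b2} \<union> gateE \<union> gateX"
  shows "winding_number (loop a1 b1) z - winding_number (loop a2 b2) z
       = winding_number arcX z - winding_number arcE z"
proof -
  have n: "z \<notin> \<phi> ` A" if "A \<subseteq> {a1..b2}" for A using assms that by blast
  have "winding_number (subpath a1 b2 \<phi>) z
      = winding_number (subpath a1 b1 \<phi>) z + winding_number (subpath b1 b2 \<phi>) z"
    "winding_number (subpath b1 b2 \<phi>) z
      = winding_number (subpath b1 b \<phi>) z + winding_number (subpath b b2 \<phi>) z"
    "winding_number (subpath a1 b2 \<phi>) z
      = winding_number (subpath a1 a2 \<phi>) z + winding_number (subpath a2 b2 \<phi>) z"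
    "winding_number (subpath a1 a2 \<phi>) z
      = winding_number (subpath a1 a \<phi>) z + winding_number (subpath a a2 \<phi>) z"
    by (rule winding_number_subpath_split[OF cont]; use order n in auto)+
  moreover have "z \<notin> halfX" "z \<notin> halfE"
    using assms n[of "{a..a2}"] n[of "{b..b2}"] n[of "{a1..a}"] n[of "{b1..b}"] order
    by (auto simp: halfX_def halfE_def)
  moreover have "winding_number (loop a1 b1) z
      = winding_number (subpath a1 b1 \<phi>) z - winding_number (linepath (\<phi> a1) (\<phi> b1)) z"
    "winding_number (loop a2 b2) z
      = winding_number (subpath a2 b2 \<phi>) z - winding_number (linepath (\<phi> a2) (\<phi> b2)) z"
    by (rule winding_loop; use assms n[of "{a2..b2}"] n[of "{a1..b1}"] order in simp)+
  ultimately show ?thesis using winding_arcX[of z] winding_arcE[of z] by algebra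
qed

lemma seg_subset_D: "gateE \<subseteq> D" "gate \<subseteq> D" "gateX \<subseteq> D"
proof -
  have "\<phi> t \<in> D" if "t \<in> {a1..a2} \<union> {b1..b2}" for t using D(2,3) that by blast
  then show "gateE \<subseteq> D" "gate \<subseteq> D" "gateX \<subseteq> D"
    using D(1) order by (simp_all add: closed_segment_subset)
qed

lemma halves_subset_D: "halfE \<subseteq> D" "halfX \<subseteq> D"
proof -
  have "\<phi> ` {a1..a} \<subseteq> D" "\<phi> ` {b1..b} \<subseteq> D" "\<phi> ` {a..a2} \<subseteq> D" "\<phi> ` {b..b2} \<subseteq> D"
    by (rule order_trans[OF image_mono D(2)] order_trans[OF image_mono D(3)]; use order in auto)+
  then show "halfE \<subseteq> D" "halfX \<subseteq> D" using seg_subset_D by (simp_all add: halfE_def halfX_def)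
qed

lemma connected_image: "connected (\<phi> ` {u..v})" if "0 \<le> u"
  using that by (intro connected_continuous_image continuous_on_subset[OF cont]) auto

lemma clear_Int:
  assumes "open_segment (\<phi> a) (\<phi> b) \<inter> \<phi> ` {a1..b2} = {}"
  shows "gate \<inter> \<phi> ` {a1..b2} = {\<phi> a, \<phi> b}"
  using assms order by (auto simp: open_segment_def)

text \<open>Outside \<^term>\<open>D\<close> the three loops have the same winding number. Hence a later passage through
  the gate, which by \<open>H1\<close> comes from outside \<^term>\<open>D\<close> without meeting \<^term>\<open>gateX\<close>, arrives with the
  winding number of \<^term>\<open>\<phi> a1\<close>, just as the recurrence to \<^term>\<open>\<phi> a1\<close> does if there is no such passage.\<close>

lemma no_return:
  assumes clear: "open_segment (\<phi> a) (\<phi> b) \<inter> \<phi> ` {a1..b2} = {}"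
    and rec: "\<And>e M. e > 0 \<Longrightarrow> \<exists>t\<ge>M. dist (\<phi> t) (\<phi> a1) < e"
    and H1: "\<And>s t. \<lbrakk>0 \<le> s; s \<le> t; \<phi> ` {s..t} \<subseteq> D; \<phi> s \<in> gateX; \<phi> t \<in> gate\<rbrakk> \<Longrightarrow> False"
  shows False
proof -
  let ?wE = "winding_number (loop a1 b1)" and ?wm = "winding_number (loop a b)"
    and ?wX = "winding_number (loop a2 b2)"
  note gate_Int = clear_Int[OF clear]
  \<comment> \<open>The goal of the argument is the chain \<open>?wE z = ?wE (\<phi> b) = ?wE
    (\<phi> b2) = ?wm (\<phi> b2) = ?wX (\<phi> a) = ?wX z\<close> for a point \<open>z\<close> of
    the gate. The present equality follows the first strand, which meets the last loop only from
    time \<open>a2\<close> on.\<close>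
  have XE: "?wX (\<phi> a) = ?wX (\<phi> a1)"
  proof (rule winding_loop_eq[where S = "\<phi> ` {a1..a}"])
    show "\<phi> ` {a1..a} \<inter> (\<phi> ` {a2..b2} \<union> gateX) = {}"
      using order by (auto simp: phi_in_seg phi_eq)
  qed (use order connected_image in auto)
  \<comment> \<open>\<open>\<phi> a1\<close> is outside the X half, whose boundary is the difference
    of the two loops.\<close>
  have mE: "?wm (\<phi> a1) = ?wX (\<phi> a1)"
  proof -
    have *: "\<phi> a1 \<notin> halfX \<union> gate" using outE halfE_Int_gate halves_Int order
      by (auto simp: halfX_def phi_in_seg phi_eq)
    have "\<phi> a1 \<in> outside (halfX \<union> gate)" using out1 by (simp add: halfX_def)
    then have "winding_number arcX (\<phi> a1) = winding_number (linepath (\<phi> a) (\<phi> b)) (\<phi> a1)"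
      using winding_closed(1)[OF arcX(1) arcm arcX(3) _ arcX(4)] arcX(2) halfX_Int_gate * by simp
    moreover have "\<phi> a1 \<notin> \<phi> ` {a..b2} \<union> gateX \<union> gate" using order by (auto simp: phi_in_seg phi_eq)
    ultimately show ?thesis using winding_m_X[of "\<phi> a1"] by simp
  qed
  \<comment> \<open>The link that needs the future of the curve: it is followed from
    \<open>b2\<close> on, either to its next hit of the gate or, if there is none, to a return close
    to \<open>\<phi> a1\<close>.\<close>
  have mX: "?wm (\<phi> b2) = ?wX (\<phi> a)"
  proof (cases "\<exists>c>b. \<phi> c \<in> gate")
    case False
    have closed: "closed (path_image (loop a b))" using loop(1)[of a b] order closed_path_image by simp
    have "\<phi> a1 \<notin> path_image (loop a b)" using loop[of a b] order by (auto simp: phi_in_seg phi_eq)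
    then obtain e where e: "e > 0" "ball (\<phi> a1) e \<subseteq> - path_image (loop a b)"
      using closed open_contains_ball[of "- path_image (loop a b)"] by (auto simp: open_Compl)
    obtain t where t: "t \<ge> b2" "dist (\<phi> t) (\<phi> a1) < e" using rec[OF e(1)] by blast
    have "?wm (\<phi> t) = ?wm (\<phi> a1)"
      by (rule winding_loop_eq[where S = "ball (\<phi> a1) e"])
        (use e t order loop[of a b] in \<open>auto simp: dist_commute\<close>)
    moreover have "?wm (\<phi> b2) = ?wm (\<phi> t)"
    proof (rule winding_loop_eq[where S = "\<phi> ` {b2..t}"])
      have "\<phi> ` {b2..t} \<inter> gate = {}" using False order by auto
      moreover have "\<phi> ` {b2..t} \<inter> \<phi> ` {a..b} = {}" using order by (auto simp: phi_eq)
      ultimately show "\<phi> ` {b2..t} \<inter> (\<phi> ` {a..b} \<union> gate) = {}" by blast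
    qed (use order t connected_image in auto)
    ultimately show ?thesis using XE mE by simp
  next
    case True
    then obtain c0 where c0: "c0 > b" "\<phi> c0 \<in> gate" by blast
    have c0b: "c0 > b2"
    proof (rule ccontr)
      assume "\<not> ?thesis"
      then have "\<phi> c0 \<in> {\<phi> a, \<phi> b}" using c0 gate_Int order by fastforce
      then show False using c0 order by (auto simp: phi_eq)
    qed
    define C where "C = {t \<in> {b2..c0}. \<phi> t \<in> gate}"
    have C: "closed C" "C \<noteq> {}" "bdd_below C"
    proof -
      have "closed ({b2..c0} \<inter> \<phi> -` gate)"
        by (rule continuous_closed_preimage)
          (use order in \<open>auto intro: continuous_on_subset[OF cont]\<close>)
      then show "closed C" unfolding C_def vimage_def Int_def by simp
    qed (use c0 c0b in \<open>auto simp: C_def\<close>)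
    \<comment> \<open>The first time after \<open>b2\<close> at which the gate is hit; up to then
      the curve does not cross the loop closed by the gate.\<close>
    define c where "c = Inf C"
    have "c \<in> C" unfolding c_def using closed_contains_Inf C by blast
    then have c: "b2 \<le> c" "\<phi> c \<in> gate" by (auto simp: C_def)
    have cb: "b2 < c" using c order phi_in_seg(2)[of b2] by (cases "c = b2") auto
    have before: "\<phi> t \<notin> gate" if "b2 \<le> t" "t < c" for t
    proof
      assume "\<phi> t \<in> gate"
      then have "t \<in> C" using that \<open>c \<in> C\<close> by (auto simp: C_def)
      then show False using that cInf_lower[OF _ C(3)] c_def by fastforce
    qed
    define K where "K = {t \<in> {b2..c}. \<phi> t \<in> - D}"
    have K: "closed K" "bdd_above K"
    proof -
      have "closed ({b2..c} \<inter> \<phi> -` (- D))"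
        by (rule continuous_closed_preimage)
          (use order open_D in \<open>auto intro: continuous_on_subset[OF cont]\<close>)
      then show "closed K" unfolding K_def vimage_def Int_def by simp
    qed (auto simp: K_def)
    \<comment> \<open>Without an excursion out of \<open>D\<close>, the piece from \<open>b2\<close>
      to \<open>c\<close> would be a passage from \<open>gateX\<close> to the gate, forbidden by
      \<open>H1\<close>.\<close>
    have "K \<noteq> {}"
    proof
      assume "K = {}"
      then have "\<phi> ` {b2..c} \<subseteq> D" by (auto simp: K_def)
      then show False using H1[of b2 c] c order by auto
    qed
    \<comment> \<open>The last time before \<open>c\<close> off \<open>D\<close>. There the loops
      closed by \<open>gate\<close> and \<open>gateX\<close> can be exchanged, as the X half lies in
      \<open>D\<close>.\<close>
    define d where "d = Sup K"
    have "d \<in> K" unfolding d_def using closed_contains_Sup K \<open>K \<noteq> {}\<close> by blast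
    then have d: "b2 \<le> d" "d \<le> c" "\<phi> d \<notin> D" by (auto simp: K_def)
    have after: "\<phi> t \<in> D" if "d < t" "t \<le> c" for t
    proof (rule ccontr)
      assume "\<phi> t \<notin> D"
      then have "t \<in> K" using that d by (auto simp: K_def)
      then show False using that cSup_upper[OF _ K(2)] d_def by fastforce
    qed
    have dc: "d < c" using d c seg_subset_D by (cases "d = c") auto
    have bd: "b2 < d" using d D(3) order by (cases "d = b2") (auto simp: image_subset_iff)
    have "?wm (\<phi> b2) = ?wm (\<phi> d)"
    proof (rule winding_loop_eq[where S = "\<phi> ` {b2..d}"])
      have "\<phi> ` {b2..d} \<inter> gate = {}" using before dc by auto
      moreover have "\<phi> ` {b2..d} \<inter> \<phi> ` {a..b} = {}" using order by (auto simp: phi_eq)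
      ultimately show "\<phi> ` {b2..d} \<inter> (\<phi> ` {a..b} \<union> gate) = {}" by blast
    qed (use order d connected_image in auto)
    also have "\<dots> = ?wX (\<phi> d)"
    proof -
      have nd: "\<phi> d \<notin> halfX \<union> gate" using halves_subset_D seg_subset_D d by blast
      have "\<phi> d \<in> outside (halfX \<union> gate)"
        using outside_subset_convex[OF D(1), of "halfX \<union> gate"] halves_subset_D seg_subset_D d by blast
      then have "winding_number arcX (\<phi> d) = winding_number (linepath (\<phi> a) (\<phi> b)) (\<phi> d)"
        using winding_closed(1)[OF arcX(1) arcm arcX(3) _ arcX(4), of "\<phi> d"]
          arcX(2) halfX_Int_gate nd by simp
      moreover have "\<phi> d \<notin> \<phi> ` {a..b2}" using bd order by (auto simp: phi_eq)
      ultimately show ?thesis using winding_m_X[of "\<phi> d"] d seg_subset_D by auto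
    qed
    \<comment> \<open>After \<open>d\<close> the curve stays in \<open>D\<close> up to
      \<open>c\<close>, so meeting \<open>gateX\<close> on the way would again contradict
      \<open>H1\<close>.\<close>
    also have "\<dots> = ?wX (\<phi> c)"
    proof (rule winding_loop_eq[where S = "\<phi> ` {d..c}"])
      have "\<phi> t \<notin> gateX" if "t \<in> {d..c}" for t
      proof
        assume t: "\<phi> t \<in> gateX"
        then have "d < t" using seg_subset_D d that by (cases "d = t") auto
        then have "\<phi> ` {t..c} \<subseteq> D" using after by auto
        then show False using H1[of t c] t c that order bd by auto
      qed
      moreover have "\<phi> ` {d..c} \<inter> \<phi> ` {a2..b2} = {}" using order bd by (auto simp: phi_eq)
      ultimately show "\<phi> ` {d..c} \<inter> (\<phi> ` {a2..b2} \<union> gateX) = {}" by blast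
    qed (use order d dc connected_image in auto)
    \<comment> \<open>From \<open>\<phi> c\<close> the gate itself is followed to
      \<open>\<phi> a\<close>. By \<open>clear\<close> the part of the curve in the last loop could
      meet it only at an end of the gate; \<open>\<phi> b\<close> is not on this piece and
      \<open>a\<close> precedes \<open>a2\<close>.\<close>
    also have "\<dots> = ?wX (\<phi> a)"
    proof (rule winding_loop_eq[where S = "closed_segment (\<phi> a) (\<phi> c)"])
      have sub: "closed_segment (\<phi> a) (\<phi> c) \<subseteq> gate" using c by (simp add: subset_closed_segment)
      have "\<phi> b \<notin> closed_segment (\<phi> a) (\<phi> c)"
      proof
        assume "\<phi> b \<in> closed_segment (\<phi> a) (\<phi> c)"
        then have "\<phi> b = \<phi> c" using c(2)
          by (metis between_antisym between_commute between_mem_segment)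
        then show False using cb order by (simp add: phi_eq)
      qed
      moreover have "\<phi> a \<notin> \<phi> ` {a2..b2}" using order by (auto simp: phi_eq)
      moreover have "\<phi> ` {a2..b2} \<subseteq> \<phi> ` {a1..b2}" using order by auto
      moreover have "closed_segment (\<phi> a) (\<phi> c) \<inter> \<phi> ` {a1..b2} \<subseteq> {\<phi> a, \<phi> b}"
        using gate_Int sub by blast
      ultimately have "closed_segment (\<phi> a) (\<phi> c) \<inter> \<phi> ` {a2..b2} = {}"
        using disjoint_between by metis
      moreover have "closed_segment (\<phi> a) (\<phi> c) \<inter> gateX = {}" using sub seg_disj(3) by blast
      ultimately show "closed_segment (\<phi> a) (\<phi> c) \<inter> (\<phi> ` {a2..b2} \<union> gateX) = {}" by blast
    qed (use order in auto)
    finally show ?thesis .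
  qed
  \<comment> \<open>\<open>\<phi> b2\<close> is outside the E half, so there the first loop may be
    exchanged for the middle one.\<close>
  have EX: "?wE (\<phi> b2) = ?wX (\<phi> a)"
  proof -
    have *: "\<phi> b2 \<notin> halfE \<union> gate" using order by (auto simp: halfE_def phi_in_seg phi_eq)
    have "\<phi> b2 \<in> outside (halfE \<union> gate)" using out2 by (simp add: halfE_def)
    then have "winding_number arcE (\<phi> b2) = winding_number (linepath (\<phi> a) (\<phi> b)) (\<phi> b2)"
      using winding_closed(1)[OF arcE(1) arcm arcE(3) _ arcE(4)] arcE(2) halfE_Int_gate * by simp
    moreover have "\<phi> b2 \<notin> \<phi> ` {a1..b} \<union> gateE \<union> gate" using order by (auto simp: phi_in_seg phi_eq)
    ultimately show ?thesis using winding_E_m[of "\<phi> b2"] mX by simp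
  qed
  have Eb: "?wE (\<phi> b) = ?wE (\<phi> b2)"
  proof (rule winding_loop_eq[where S = "\<phi> ` {b..b2}"])
    show "\<phi> ` {b..b2} \<inter> (\<phi> ` {a1..b1} \<union> gateE) = {}"
      using order by (auto simp: phi_in_seg phi_eq)
  qed (use order connected_image in auto)
  \<comment> \<open>Any point of the gate other than its ends would do. From \<open>z\<close> the
    first loop is avoided on the way to \<open>\<phi> b\<close>, and the last loop on the way to
    \<open>\<phi> a\<close>.\<close>
  define z where "z = midpoint (\<phi> a) (\<phi> b)"
  have z: "z \<in> gate" "z \<noteq> \<phi> a" "z \<noteq> \<phi> b" using ends_distinct by (simp_all add: z_def midpoint_eq_endpoint)
  have sub: "closed_segment (\<phi> a) z \<subseteq> gate" "closed_segment z (\<phi> b) \<subseteq> gate"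
    using z by (simp_all add: subset_closed_segment)
  have nb: "\<phi> b \<notin> closed_segment (\<phi> a) z" "\<phi> a \<notin> closed_segment z (\<phi> b)"
    using z unfolding between_mem_segment[symmetric] by (metis between_antisym between_commute between_mem_segment)+
  have "?wE z = ?wE (\<phi> b)"
  proof (rule winding_loop_eq[where S = "closed_segment z (\<phi> b)"])
    have "\<phi> b \<notin> \<phi> ` {a1..b1}" using order by (auto simp: phi_eq)
    moreover have "\<phi> ` {a1..b1} \<subseteq> \<phi> ` {a1..b2}" using order by auto
    moreover have "closed_segment z (\<phi> b) \<inter> \<phi> ` {a1..b2} \<subseteq> {\<phi> b, \<phi> a}" using gate_Int sub by blast
    ultimately have "closed_segment z (\<phi> b) \<inter> \<phi> ` {a1..b1} = {}" using disjoint_between nb(2) by metis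
    moreover have "closed_segment z (\<phi> b) \<inter> gateE = {}" using sub seg_disj(1) by blast
    ultimately show "closed_segment z (\<phi> b) \<inter> (\<phi> ` {a1..b1} \<union> gateE) = {}" by blast
  qed (use order in auto)
  moreover have "?wX z = ?wX (\<phi> a)"
  proof (rule winding_loop_eq[where S = "closed_segment (\<phi> a) z"])
    have "\<phi> a \<notin> \<phi> ` {a2..b2}" using order by (auto simp: phi_eq)
    moreover have "\<phi> ` {a2..b2} \<subseteq> \<phi> ` {a1..b2}" using order by auto
    moreover have "closed_segment (\<phi> a) z \<inter> \<phi> ` {a1..b2} \<subseteq> {\<phi> a, \<phi> b}" using gate_Int sub by blast
    ultimately have "closed_segment (\<phi> a) z \<inter> \<phi> ` {a2..b2} = {}" using disjoint_between nb(1) by metis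
    moreover have "closed_segment (\<phi> a) z \<inter> gateX = {}" using sub seg_disj(3) by blast
    ultimately show "closed_segment (\<phi> a) z \<inter> (\<phi> ` {a2..b2} \<union> gateX) = {}" by blast
  qed (use order in auto)
  ultimately have "?wE z = ?wX z" using Eb EX by simp
  moreover have "z \<notin> \<phi> ` {a1..b2} \<union> gateE \<union> gateX" using z gate_Int seg_disj by blast
  \<comment> \<open>The equality contradicts that \<open>z\<close> is inside the strip, where the
    two arcs have different winding numbers.\<close>
  ultimately have "winding_number arcX z = winding_number arcE z" using winding_E_X[of z] by simp
  moreover have "z \<in> inside (halfE \<union> halfX)" using gate_inside z by blast
  moreover have "z \<notin> halfE \<union> halfX" using z halfE_Int_gate halfX_Int_gate by blast
  ultimately show False
    using winding_closed(2)[OF arcE(1) arcX(1) arcE(3) arcX(3) arcE(4) arcX(4), unfolded arcE(2) arcX(2),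
        OF halves_Int, of z] by metis
qed

end

section \<open>Narrowing the strip until its gate is clear\<close>

text \<open>Adjoining a limit point keeps \<open>A\<close> connected. With \<open>A\<close> the
  outside of a strip, this yields the two outside conditions for a narrower strip within it.\<close>

lemma closure_connected_unbounded_in_outside:
  fixes Q :: "'a::euclidean_space set"
  assumes "connected A" "\<not> bounded A" "A \<inter> Q = {}" "y \<in> closure A" "y \<notin> Q"
  shows "y \<in> outside Q"
proof -
  have "connected (insert y A)"
    using connected_intermediate_closure[OF assms(1), of "insert y A"] assms(4) closure_subset by blast
  then have "insert y A \<subseteq> connected_component_set (- Q) y"
    using assms by (intro connected_component_maximal) auto
  then have "\<not> bounded (connected_component_set (- Q) y)"
    using assms(2) bounded_subset by blast
  then show ?thesis by (simp add: outside)
qed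

context strip begin

text \<open>If the curve meets the gate between the two strands, the strip is cut down to one whose
  gate is clear. \<open>H1\<close> and \<open>H2\<close> ensure that the strand used for this
  crosses the strip from \<open>gateE\<close> to \<open>gateX\<close>.\<close>

lemma no_double_transit:
  assumes rec: "\<And>e M. e > 0 \<Longrightarrow> \<exists>t\<ge>M. dist (\<phi> t) (\<phi> a1) < e"
    and H1: "\<And>s t. \<lbrakk>0 \<le> s; s \<le> t; \<phi> ` {s..t} \<subseteq> D; \<phi> s \<in> gateX; \<phi> t \<in> gate\<rbrakk> \<Longrightarrow> False"
    and H2: "\<And>s t. \<lbrakk>0 \<le> s; s \<le> t; \<phi> ` {s..t} \<subseteq> D; \<phi> s \<in> gate; \<phi> t \<in> gateE\<rbrakk> \<Longrightarrow> False"
  shows False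
proof (cases "open_segment (\<phi> a) (\<phi> b) \<inter> \<phi> ` {a1..b2} = {}")
  case True
  then show False using no_return rec H1 by blast
next
  case False
  define I where "I = inside (halfE \<union> halfX)"
  define Out where "Out = outside (halfE \<union> halfX)"
  have J: "simple_path (arcE +++ reversepath arcX)"
    "pathfinish (arcE +++ reversepath arcX) = pathstart (arcE +++ reversepath arcX)"
    "path_image (arcE +++ reversepath arcX) = halfE \<union> halfX"
    using loop_of_two_arcs[OF arcE(1) arcX(1) arcE(3) arcX(3) arcE(4) arcX(4)]
    by (simp_all add: arcE(2) arcX(2) halves_Int)
  have I: "open I" "frontier I = halfE \<union> halfX" "I \<inter> (halfE \<union> halfX) = {}"
    using Jordan_inside_outside[OF J(1,2)] inside_no_overlap by (auto simp: J(3) I_def)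
  have Out: "connected Out" "\<not> bounded Out" "frontier Out = halfE \<union> halfX" "Out \<inter> (halfE \<union> halfX) = {}"
    "Out \<inter> I = {}"
    using Jordan_inside_outside[OF J(1,2)] outside_no_overlap[of "halfE \<union> halfX"]
      inside_Int_outside[of "halfE \<union> halfX"]
    by (simp_all add: J(3) I_def Out_def Int_commute)
  have ID: "I \<subseteq> D"
    using outside_subset_convex[OF D(1), of "halfE \<union> halfX"] halves_subset_D inside_Int_outside
    unfolding I_def by blast
  have gate_I: "gate - {\<phi> a, \<phi> b} \<subseteq> I" using gate_inside by (simp add: I_def)
  have gates_in_halves: "gateE \<subseteq> halfE" "gateX \<subseteq> halfX" by (auto simp: halfE_def halfX_def)
  \<comment> \<open>By injectivity the curve between the two strands cannot leave the strip through
    a strand, only through an end segment.\<close>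
  have mid: "\<phi> t \<in> gateE \<or> \<phi> t \<in> gateX" if "t \<in> {a2..b1}" "\<phi> t \<in> halfE \<union> halfX" for t
    using that order by (auto simp: halfE_def halfX_def phi_eq)
  \<comment> \<open>The strand through the point of \<^term>\<open>gate\<close> nearest to \<^term>\<open>\<phi> a\<close> crosses the strip and replaces the second strand.\<close>
  define H where "H = \<phi> ` {a2..b1} \<inter> gate"
  have "compact (\<phi> ` {a2..b1})"
    using order by (intro compact_continuous_image continuous_on_subset[OF cont]) auto
  then have "closed H" by (simp add: H_def compact_imp_closed closed_Int)
  moreover have "H \<noteq> {}"
  proof -
    obtain t where t: "t \<in> {a1..b2}" "\<phi> t \<in> open_segment (\<phi> a) (\<phi> b)" using False by blast
    then have "\<phi> t \<in> gate" "t \<noteq> a" "t \<noteq> b" by (auto simp: open_segment_def)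
    then have "t \<in> {a2..b1}" using phi_in_seg(2)[of t] t order by fastforce
    then have "\<phi> t \<in> H" using \<open>\<phi> t \<in> gate\<close> unfolding H_def by blast
    then show ?thesis by blast
  qed
  ultimately obtain z where z: "z \<in> H" "\<And>y. y \<in> H \<Longrightarrow> dist (\<phi> a) z \<le> dist (\<phi> a) y"
    using distance_attains_inf[of H "\<phi> a"] by blast
  then obtain c where c: "z = \<phi> c" "c \<in> {a2..b1}" "\<phi> c \<in> gate" by (auto simp: H_def)
  have c_strict: "a2 < c" "c < b1"
    using c phi_in_seg(2)[of a2] phi_in_seg(2)[of b1] order by (cases "c = a2"; cases "c = b1"; auto)+
  have sub: "closed_segment (\<phi> a) (\<phi> c) \<subseteq> gate" using c by (simp add: subset_closed_segment)
  have nb: "\<phi> b \<notin> closed_segment (\<phi> a) (\<phi> c)"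
  proof
    assume "\<phi> b \<in> closed_segment (\<phi> a) (\<phi> c)"
    then have "\<phi> b = \<phi> c" using c(3) by (metis between_antisym between_commute between_mem_segment)
    then show False using c_strict order by (simp add: phi_eq)
  qed
  have clear: "open_segment (\<phi> a) (\<phi> c) \<inter> \<phi> ` {a1..b2} = {}"
  proof (rule ccontr)
    assume "\<not> ?thesis"
    then obtain t where t: "t \<in> {a1..b2}" "\<phi> t \<in> open_segment (\<phi> a) (\<phi> c)" by blast
    then have *: "\<phi> t \<in> gate" "t \<noteq> a" "t \<noteq> b" using sub nb by (auto simp: open_segment_def)
    then have "t \<in> {a2..b1}" using phi_in_seg(2)[of t] t order by fastforce
    then have "dist (\<phi> a) (\<phi> c) \<le> dist (\<phi> a) (\<phi> t)" using z * c by (auto simp: H_def)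
    then show False using dist_in_open_segment[OF t(2)] by (simp add: dist_commute)
  qed
  have cI: "\<phi> c \<in> I" using gate_I c c_strict order by (auto simp: phi_eq)
  have closed: "closed {t \<in> {u..v}. \<phi> t \<notin> I}" if "0 \<le> u" for u v
  proof -
    have "closed ({u..v} \<inter> \<phi> -` (- I))"
      by (rule continuous_closed_preimage) (use that I in \<open>auto intro: continuous_on_subset[OF cont]\<close>)
    then show ?thesis unfolding vimage_def Int_def by simp
  qed
  \<comment> \<open>A limit of points of \<open>I\<close> that is not in \<open>I\<close> lies on
    its frontier.\<close>
  have boundary: "\<phi> t \<in> halfE \<union> halfX" if "\<phi> t \<notin> I" "\<phi> ` A \<subseteq> I" "t \<in> closure A" "A \<subseteq> {0..}" for t A
  proof -
    have "continuous_on (closure A) \<phi>"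
      by (rule continuous_on_subset[OF cont closure_minimal[OF that(4)]]) simp
    then have "\<phi> ` closure A \<subseteq> closure I"
      using that(2) closure_subset[of I] by (intro image_closure_subset) auto
    then have "\<phi> t \<in> closure I" using that(3) by blast
    then show ?thesis using that(1) I by (simp add: closure_Un_frontier)
  qed
  \<comment> \<open>Backwards from \<open>c\<close>, the curve was last off \<open>I\<close> at time
    \<open>t1\<close>. It entered through an end segment, and \<open>H1\<close> rules out
    \<open>gateX\<close>.\<close>
  obtain t1 where t1: "a2 < t1" "t1 < c" "\<phi> t1 \<in> gateE" "\<phi> ` {t1<..c} \<subseteq> I"
  proof -
    define K where "K = {t \<in> {a2..c}. \<phi> t \<notin> I}"
    define t1 where "t1 = Sup K"
    have "\<phi> a2 \<in> halfX" using order by (auto simp: halfX_def)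
    then have "a2 \<in> K" using I c_strict by (auto simp: K_def)
    have bdd: "bdd_above K" by (auto simp: K_def)
    have "closed K" using closed order by (simp add: K_def)
    then have "t1 \<in> K" unfolding t1_def using closed_contains_Sup bdd \<open>a2 \<in> K\<close> by blast
    then have t1: "a2 \<le> t1" "t1 \<le> c" "\<phi> t1 \<notin> I" by (auto simp: K_def)
    then have t1c: "t1 < c" using cI by (cases "t1 = c") auto
    have sub: "\<phi> ` {t1<..c} \<subseteq> I"
    proof (rule ccontr)
      assume "\<not> ?thesis"
      then obtain t where t: "t \<in> {t1<..c}" "\<phi> t \<notin> I" by blast
      then have t: "t \<in> {t1<..c}" "t \<in> K" using t1 by (simp_all add: K_def)
      then show False using cSup_upper[OF t(2) bdd] by (simp add: t1_def)
    qed
    have "t1 \<in> closure {t1<..c}" using t1c by (simp add: closure_greaterThanAtMost)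
    then have "\<phi> t1 \<in> halfE \<union> halfX" using t1 order by (intro boundary[OF _ sub]) auto
    moreover have "\<phi> ` {t1..c} \<subseteq> D"
    proof -
      have "{t1..c} = insert t1 {t1<..c}" using t1c by auto
      then show ?thesis using sub ID \<open>\<phi> t1 \<in> halfE \<union> halfX\<close> halves_subset_D by auto
    qed
    ultimately have "\<phi> t1 \<in> gateE" using H1[of t1 c] mid[of t1] t1 c order by auto
    moreover have "a2 < t1" using t1(1) phi_in_seg(1)[of a2] calculation order by (cases "t1 = a2") auto
    ultimately show ?thesis using that t1c sub by blast
  qed
  \<comment> \<open>Forwards from \<open>c\<close>, the exit from \<open>I\<close> is through an end
    segment, and \<open>H2\<close> rules out \<open>gateE\<close>.\<close>
  obtain t2 where t2: "c < t2" "t2 < b1" "\<phi> t2 \<in> gateX" "\<phi> ` {c..<t2} \<subseteq> I"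
  proof -
    define K where "K = {t \<in> {c..b1}. \<phi> t \<notin> I}"
    define t2 where "t2 = Inf K"
    have "\<phi> b1 \<in> halfE" using order by (auto simp: halfE_def)
    then have "b1 \<in> K" using I c_strict by (auto simp: K_def)
    have bdd: "bdd_below K" by (auto simp: K_def)
    have "closed K" using closed order c_strict by (simp add: K_def)
    then have "t2 \<in> K" unfolding t2_def using closed_contains_Inf bdd \<open>b1 \<in> K\<close> by blast
    then have t2: "c \<le> t2" "t2 \<le> b1" "\<phi> t2 \<notin> I" by (auto simp: K_def)
    then have t2c: "c < t2" using cI by (cases "t2 = c") auto
    have sub: "\<phi> ` {c..<t2} \<subseteq> I"
    proof (rule ccontr)
      assume "\<not> ?thesis"
      then obtain t where t: "t \<in> {c..<t2}" "\<phi> t \<notin> I" by blast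
      then have t: "t \<in> {c..<t2}" "t \<in> K" using t2 by (simp_all add: K_def)
      then show False using cInf_lower[OF t(2) bdd] by (simp add: t2_def)
    qed
    have "t2 \<in> closure {c..<t2}" using t2c by (simp add: closure_atLeastLessThan)
    then have "\<phi> t2 \<in> halfE \<union> halfX" using t2 order c_strict by (intro boundary[OF _ sub]) auto
    moreover have "\<phi> ` {c..t2} \<subseteq> D"
    proof -
      have "{c..t2} = insert t2 {c..<t2}" using t2c by auto
      then show ?thesis using sub ID \<open>\<phi> t2 \<in> halfE \<union> halfX\<close> halves_subset_D by auto
    qed
    ultimately have "\<phi> t2 \<in> gateX" using H2[of c t2] mid[of t2] t2 c c_strict order by auto
    moreover have "t2 < b1" using t2(2) phi_in_seg(3)[of b1] calculation order by (cases "t2 = b1") auto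
    ultimately show ?thesis using that t2c sub by blast
  qed
  have strand: "\<phi> ` {t1..t2} \<subseteq> insert (\<phi> t1) (insert (\<phi> t2) I)"
  proof -
    have "{t1..t2} \<subseteq> insert t1 (insert t2 ({t1<..c} \<union> {c..<t2}))" by auto
    then show ?thesis using t1(4) t2(4) by blast
  qed
  have gateE': "closed_segment (\<phi> a1) (\<phi> t1) \<subseteq> gateE" using t1 by (simp add: subset_closed_segment)
  have gateX': "closed_segment (\<phi> a2) (\<phi> t2) \<subseteq> gateX" using t2 by (simp add: subset_closed_segment)
  have disjI: "gateE \<inter> I = {}" "gateX \<inter> I = {}" using gates_in_halves I by blast+
  have sm: "closed_segment (\<phi> a) (\<phi> c) \<inter> \<phi> ` {a1..b2} \<subseteq> {\<phi> a, \<phi> c}"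
    using clear by (auto simp: open_segment_def)
  have avoid: "B \<inter> Out = {}" if "B \<subseteq> halfE \<union> halfX \<union> I" for B
    using that Out by blast
  have smI: "closed_segment (\<phi> a) (\<phi> c) \<subseteq> halfE \<union> halfX \<union> I"
    using sub gate_I halves_Int by blast
  have strandI: "\<phi> ` {t1..t2} \<subseteq> halfE \<union> halfX \<union> I"
  proof (rule order_trans[OF strand])
    show "insert (\<phi> t1) (insert (\<phi> t2) I) \<subseteq> halfE \<union> halfX \<union> I" using t1(3) t2(3) gates_in_halves by auto
  qed
  have clo: "halfE \<union> halfX \<subseteq> closure Out" using Out(3) by (auto simp: closure_Un_frontier)
  \<comment> \<open>The new segments are parts of the old ones. Apart from its ends the new strand
    runs in \<open>I\<close>, so all new curves lie in the closed old strip and miss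
    \<open>Out\<close>, whose closure contains the two witness points.\<close>
  interpret new: strip \<phi> a1 a a2 t1 c t2 D
  proof
    show "closed_segment (\<phi> a1) (\<phi> t1) \<inter> (\<phi> ` {a1..a2} \<union> \<phi> ` {t1..t2}) = {\<phi> a1, \<phi> t1}" (is "?L = ?R")
    proof
      have "gateE \<inter> \<phi> ` {a1..a2} \<subseteq> {\<phi> a1}" using order by (auto simp: phi_in_seg)
      moreover have "\<phi> t2 \<notin> gateE" using t2 seg_disj by blast
      then have "gateE \<inter> \<phi> ` {t1..t2} \<subseteq> {\<phi> t1}"
        using disjI Int_mono[OF subset_refl strand, of gateE] by auto
      ultimately show "?L \<subseteq> ?R" using gateE' by blast
      show "?R \<subseteq> ?L" using order t1 t2 by auto
    qed
    show "closed_segment (\<phi> a2) (\<phi> t2) \<inter> (\<phi> ` {a1..a2} \<union> \<phi> ` {t1..t2}) = {\<phi> a2, \<phi> t2}" (is "?L = ?R")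
    proof
      have "gateX \<inter> \<phi> ` {a1..a2} \<subseteq> {\<phi> a2}" using order by (auto simp: phi_in_seg)
      moreover have "\<phi> t1 \<notin> gateX" using t1 seg_disj by blast
      then have "gateX \<inter> \<phi> ` {t1..t2} \<subseteq> {\<phi> t2}"
        using disjI Int_mono[OF subset_refl strand, of gateX] by auto
      ultimately show "?L \<subseteq> ?R" using gateX' by blast
      show "?R \<subseteq> ?L" using order t1 t2 by auto
    qed
    show "closed_segment (\<phi> a) (\<phi> c) \<inter> (\<phi> ` {a1..a2} \<union> \<phi> ` {t1..t2}) = {\<phi> a, \<phi> c}" (is "?L = ?R")
    proof
      have "\<phi> ` {a1..a2} \<union> \<phi> ` {t1..t2} \<subseteq> \<phi> ` {a1..b2}" using order t1 t2 by auto
      then show "?L \<subseteq> ?R" using sm by blast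
      show "?R \<subseteq> ?L" using order t1 t2 by auto
    qed
    show "closed_segment (\<phi> a1) (\<phi> t1) \<inter> closed_segment (\<phi> a) (\<phi> c) = {}"
      "closed_segment (\<phi> a1) (\<phi> t1) \<inter> closed_segment (\<phi> a2) (\<phi> t2) = {}"
      "closed_segment (\<phi> a) (\<phi> c) \<inter> closed_segment (\<phi> a2) (\<phi> t2) = {}"
      using gateE' gateX' sub seg_disj by blast+
    show "\<phi> ` {t1..t2} \<subseteq> D"
      by (rule order_trans[OF strandI]) (use ID halves_subset_D in auto)
    show "\<phi> a1 \<in> outside (\<phi> ` {a..a2} \<union> closed_segment (\<phi> a2) (\<phi> t2) \<union> \<phi> ` {c..t2}
                 \<union> closed_segment (\<phi> a) (\<phi> c))"
    proof (rule closure_connected_unbounded_in_outside[OF Out(1,2)])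
      have "\<phi> ` {a..a2} \<union> closed_segment (\<phi> a2) (\<phi> t2) \<union> \<phi> ` {c..t2}
          \<union> closed_segment (\<phi> a) (\<phi> c) \<subseteq> halfE \<union> halfX \<union> I"
      proof (intro Un_least smI)
        show "\<phi> ` {a..a2} \<subseteq> halfE \<union> halfX \<union> I" unfolding halfX_def by auto
        show "closed_segment (\<phi> a2) (\<phi> t2) \<subseteq> halfE \<union> halfX \<union> I"
          using gateX' gates_in_halves by auto
        show "\<phi> ` {c..t2} \<subseteq> halfE \<union> halfX \<union> I"
          by (rule order_trans[OF image_mono strandI]) (use t1 t2 in auto)
      qed
      from avoid[OF this] show "Out \<inter> (\<phi> ` {a..a2} \<union> closed_segment (\<phi> a2) (\<phi> t2) \<union> \<phi> ` {c..t2}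
                 \<union> closed_segment (\<phi> a) (\<phi> c)) = {}" by (simp only: Int_commute)
      show "\<phi> a1 \<in> closure Out" using clo order by (auto simp: halfE_def)
      have "\<phi> a1 \<notin> gate" "\<phi> a1 \<notin> gateX" "\<phi> a1 \<notin> \<phi> ` {a..a2}" "\<phi> a1 \<notin> \<phi> ` {c..t2}"
        using order t1 t2 by (auto simp: phi_in_seg phi_eq)
      then show "\<phi> a1 \<notin> \<phi> ` {a..a2} \<union> closed_segment (\<phi> a2) (\<phi> t2) \<union> \<phi> ` {c..t2}
                 \<union> closed_segment (\<phi> a) (\<phi> c)" using sub gateX' by blast
    qed
    show "\<phi> t2 \<in> outside (\<phi> ` {a1..a} \<union> closed_segment (\<phi> a1) (\<phi> t1) \<union> \<phi> ` {t1..c}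
                 \<union> closed_segment (\<phi> a) (\<phi> c))"
    proof (rule closure_connected_unbounded_in_outside[OF Out(1,2)])
      have "\<phi> ` {a1..a} \<union> closed_segment (\<phi> a1) (\<phi> t1) \<union> \<phi> ` {t1..c}
          \<union> closed_segment (\<phi> a) (\<phi> c) \<subseteq> halfE \<union> halfX \<union> I"
      proof (intro Un_least smI)
        show "\<phi> ` {a1..a} \<subseteq> halfE \<union> halfX \<union> I" unfolding halfE_def by auto
        show "closed_segment (\<phi> a1) (\<phi> t1) \<subseteq> halfE \<union> halfX \<union> I"
          using gateE' gates_in_halves by auto
        show "\<phi> ` {t1..c} \<subseteq> halfE \<union> halfX \<union> I"
          by (rule order_trans[OF image_mono strandI]) (use t1 t2 in auto)
      qed
      from avoid[OF this] show "Out \<inter> (\<phi> ` {a1..a} \<union> closed_segment (\<phi> a1) (\<phi> t1) \<union> \<phi> ` {t1..c}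
                 \<union> closed_segment (\<phi> a) (\<phi> c)) = {}" by (simp only: Int_commute)
      show "\<phi> t2 \<in> closure Out" using clo t2 gates_in_halves by blast
      have "\<phi> t2 \<notin> gate" "\<phi> t2 \<notin> gateE" using t2 seg_disj by blast+
      moreover have "\<phi> t2 \<notin> \<phi> ` {a1..a}" "\<phi> t2 \<notin> \<phi> ` {t1..c}"
        using order t1 t2 by (auto simp: phi_eq)
      ultimately show "\<phi> t2 \<notin> \<phi> ` {a1..a} \<union> closed_segment (\<phi> a1) (\<phi> t1) \<union> \<phi> ` {t1..c}
                 \<union> closed_segment (\<phi> a) (\<phi> c)" using sub gateE' by blast
    qed
  qed (use cont inj order D open_D t1 t2 in auto)
  show False
  proof (rule new.no_return)
    have "\<phi> ` {a1..t2} \<subseteq> \<phi> ` {a1..b2}" using t2 order by auto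
    then show "open_segment (\<phi> a) (\<phi> c) \<inter> \<phi> ` {a1..t2} = {}" using clear by blast
    show False if "0 \<le> s" "s \<le> t" "\<phi> ` {s..t} \<subseteq> D" "\<phi> s \<in> closed_segment (\<phi> a2) (\<phi> t2)"
      "\<phi> t \<in> closed_segment (\<phi> a) (\<phi> c)" for s t
      using H1 that gateX' sub by blast
  qed (rule rec)
qed

end

section \<open>Building a strip from a close return\<close>

text \<open>Among the points of the segment, a pair from \<open>A\<close> and \<open>B\<close> at
  minimal distance is chosen. A further point of \<open>A\<close> or \<open>B\<close> between them
  would give a closer pair.\<close>

lemma segment_between_disjoint_closed:
  fixes A B :: "'a::euclidean_space set"
  assumes "closed A" "closed B" "A \<inter> B = {}" "p \<in> A" "q \<in> B"
  obtains p' q' where "p' \<in> A" "q' \<in> B" "closed_segment p' q' \<subseteq> closed_segment p q"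
    "closed_segment p' q' \<inter> (A \<union> B) = {p', q'}"
proof -
  let ?S = "closed_segment p q"
  have "compact (?S \<inter> A)" "closed (?S \<inter> B)" "?S \<inter> A \<noteq> {}" "?S \<inter> B \<noteq> {}"
    using assms by (auto intro: closed_Int compact_Int_closed)
  then obtain p' q' where pq: "p' \<in> ?S \<inter> A" "q' \<in> ?S \<inter> B" "dist p' q' = setdist (?S \<inter> A) (?S \<inter> B)"
    using setdist_compact_closed by metis
  have min: "dist p' q' \<le> dist x y" if "x \<in> ?S \<inter> A" "y \<in> ?S \<inter> B" for x y
    using pq(3) setdist_le_dist[OF that] by simp
  have sub: "closed_segment p' q' \<subseteq> ?S" using pq by (simp add: subset_closed_segment)
  have "x = p' \<or> x = q'" if "x \<in> closed_segment p' q'" "x \<in> A \<union> B" for x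
  proof (rule ccontr)
    assume "\<not> ?thesis"
    then have "x \<in> open_segment p' q'" using that by (simp add: open_segment_def)
    then have "dist x p' < dist p' q'" "dist x q' < dist p' q'"
      using dist_in_open_segment by blast+
    then show False using min[of x q'] min[of p' x] that sub pq by (auto simp: dist_commute)
  qed
  then have "closed_segment p' q' \<inter> (A \<union> B) = {p', q'}" using pq by auto
  then show ?thesis using that pq sub by blast
qed

text \<open>An arc does not separate the plane, so a sufficiently thin neighbourhood of it does not
  enclose \<^term>\<open>P\<close> either.\<close>

lemma outside_near_arc:
  fixes g :: "real \<Rightarrow> 'a::euclidean_space"
  assumes "arc g" "2 \<le> DIM('a)" "convex D" "D \<noteq> UNIV" "path_image g \<subseteq> D"
    and P: "compact P" "connected P" "P \<inter> path_image g = {}"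
  shows "\<exists>\<mu>>0. \<forall>Q\<subseteq>D. (\<forall>y\<in>Q. \<exists>x\<in>path_image g. dist x y < \<mu>) \<longrightarrow> P \<subseteq> outside Q"
proof (cases "P = {}")
  case True
  then show ?thesis by (intro exI[of _ 1]) simp
next
  case False
  then obtain p where p: "p \<in> P" by blast
  \<comment> \<open>A point off \<open>D\<close> is outside every \<open>Q\<close> in
    \<open>D\<close>. It is joined to \<open>P\<close> in the complement of the arc, and the
    distance of this connected set \<open>?K\<close> from the arc serves as \<mu>.\<close>
  obtain f where f: "f \<notin> D" using assms(4) by blast
  have "p \<in> - path_image g" "f \<in> - path_image g" using p P f assms(5) by blast+
  then obtain h where h: "path h" "path_image h \<subseteq> - path_image g" "pathstart h = p" "pathfinish h = f"
    using path_connected_arc_complement[OF assms(1,2)] unfolding path_connected_def by blast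
  let ?K = "P \<union> path_image h"
  have fp: "f \<in> path_image h" "p \<in> path_image h" using h pathstart_in_path_image pathfinish_in_path_image by metis+
  have K: "compact ?K" "connected ?K" "?K \<inter> path_image g = {}"
    using P h p fp by (auto intro!: connected_Un compact_Un compact_path_image connected_path_image)
  have "setdist ?K (path_image g) > 0"
    using K p arc_imp_path[OF assms(1)] compact_path_image[THEN compact_imp_closed]
    by (subst setdist_gt_0_compact_closed) auto
  moreover have "P \<subseteq> outside Q"
    if QD: "Q \<subseteq> D"
      and near: "\<forall>y\<in>Q. \<exists>x\<in>path_image g. dist x y < setdist ?K (path_image g)" for Q
  proof
    fix x assume "x \<in> P"
    have "?K \<subseteq> - Q"
    proof
      fix k assume k: "k \<in> ?K"
      show "k \<in> - Q"
      proof
        assume "k \<in> Q"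
        then obtain x where "x \<in> path_image g" "dist x k < setdist ?K (path_image g)" using near by blast
        then show False using setdist_le_dist[OF k, of x "path_image g"] by (simp add: dist_commute)
      qed
    qed
    then have "connected_component (- Q) f x"
      unfolding connected_component_def using K(2) fp \<open>x \<in> P\<close> by blast
    moreover have "f \<in> outside Q" using outside_subset_convex[OF assms(3) QD] f by blast
    ultimately show "x \<in> outside Q" using outside_same_component by blast
  qed
  ultimately show ?thesis by blast
qed

text \<open>The inverse of a continuous injection of a compact interval is uniformly
  continuous.\<close>

lemma inverse_modulus:
  fixes \<phi> :: "real \<Rightarrow> 'a::metric_space"
  assumes "continuous_on {u..v} \<phi>" "inj_on \<phi> {u..v}" "\<kappa> > 0"
  obtains \<eta> where "\<eta> > 0"
    "\<And>s t. \<lbrakk>s \<in> {u..v}; t \<in> {u..v}; dist (\<phi> s) (\<phi> t) < \<eta>\<rbrakk> \<Longrightarrow> \<bar>s - t\<bar> < \<kappa>"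
proof -
  let ?g = "the_inv_into {u..v} \<phi>"
  have g: "?g (\<phi> s) = s" if "s \<in> {u..v}" for s using the_inv_into_f_f assms(2) that by metis
  have "continuous_on (\<phi> ` {u..v}) ?g"
    using continuous_on_inv[OF assms(1)] g by auto
  then have "uniformly_continuous_on (\<phi> ` {u..v}) ?g"
    using assms(1) by (intro compact_uniformly_continuous compact_continuous_image) auto
  then obtain d where "d > 0" "\<And>x y. \<lbrakk>x \<in> \<phi> ` {u..v}; y \<in> \<phi> ` {u..v}; dist y x < d\<rbrakk> \<Longrightarrow> dist (?g y) (?g x) < \<kappa>"
    using assms(3) unfolding uniformly_continuous_on_def by metis
  then show ?thesis using that[of d] g by (metis dist_real_def imageI)
qed

text \<open>The times \<open>t1\<close>, \<open>t0\<close>, \<open>t2\<close> belong to points near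
  e, p and x. A close return of the curve provides the second strand, and the ends of the strip are
  so near these points that \<open>H1\<close> and \<open>H2\<close> become the hypotheses on the
  gates.\<close>

lemma no_one_way_passage:
  fixes \<phi> :: "real \<Rightarrow> complex"
  assumes cont: "continuous_on {0..} \<phi>" and inj: "inj_on \<phi> {0..}"
    and rec: "\<And>N e M. e > 0 \<Longrightarrow> \<exists>T\<ge>M. \<forall>s\<in>{0..N}. dist (\<phi> (T + s)) (\<phi> s) < e"
    and order: "0 \<le> t1" "t1 < t0" "t0 < t2"
    and D: "open D" "convex D" "D \<noteq> UNIV" "\<phi> ` {t1..t2} \<subseteq> D" and "\<epsilon> > 0"
    and H1: "\<And>s t. \<lbrakk>0 \<le> s; s \<le> t; \<phi> ` {s..t} \<subseteq> D; dist (\<phi> s) (\<phi> t2) < \<epsilon>; dist (\<phi> t) (\<phi> t0) < \<epsilon>\<rbrakk> \<Longrightarrow> False"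
    and H2: "\<And>s t. \<lbrakk>0 \<le> s; s \<le> t; \<phi> ` {s..t} \<subseteq> D; dist (\<phi> s) (\<phi> t0) < \<epsilon>; dist (\<phi> t) (\<phi> t1) < \<epsilon>\<rbrakk> \<Longrightarrow> False"
  shows False
proof -
  have eq: "\<phi> s = \<phi> t \<longleftrightarrow> s = t" if "0 \<le> s" "0 \<le> t" for s t
    using inj_onD[OF inj] that by auto
  have comp: "compact (\<phi> ` {u..v})" "connected (\<phi> ` {u..v})" if "0 \<le> u" for u v
    using that by (auto intro!: compact_continuous_image connected_continuous_image continuous_on_subset[OF cont])
  \<comment> \<open>Times may later be moved by less than \<kappa>; a third of the shorter gap keeps
    them in order and separated.\<close>
  define \<kappa> where "\<kappa> = min (t0 - t1) (t2 - t0) / 3"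
  have \<kappa>: "\<kappa> > 0" "3 * \<kappa> \<le> t0 - t1" "3 * \<kappa> \<le> t2 - t0" using order by (auto simp: \<kappa>_def)
  have "continuous_on {t1..t2} \<phi>" "inj_on \<phi> {t1..t2}"
    using order by (auto intro: continuous_on_subset[OF cont] inj_on_subset[OF inj])
  then obtain \<eta>0 where \<eta>0: "\<eta>0 > 0"
    "\<And>s t. \<lbrakk>s \<in> {t1..t2}; t \<in> {t1..t2}; dist (\<phi> s) (\<phi> t) < \<eta>0\<rbrakk> \<Longrightarrow> \<bar>s - t\<bar> < \<kappa>"
    using inverse_modulus[of t1 t2 \<phi> \<kappa>] \<kappa>(1) by blast
  have im: "path_image (subpath u v \<phi>) = \<phi> ` {u..v}" if "u \<le> v" for u v
    using that by (simp add: path_image_subpath_gen closed_segment_eq_real_ivl)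
  have arcs: "arc (subpath (t0-\<kappa>) t2 \<phi>)" "arc (subpath t1 (t0+\<kappa>) \<phi>)"
    by (rule subpath_arc[OF cont inj]; use order \<kappa> in auto)+
  have ims: "path_image (subpath (t0-\<kappa>) t2 \<phi>) = \<phi> ` {t0-\<kappa>..t2}"
    "path_image (subpath t1 (t0+\<kappa>) \<phi>) = \<phi> ` {t1..t0+\<kappa>}"
    using order \<kappa> by (simp_all add: im)
  have imD: "path_image (subpath (t0-\<kappa>) t2 \<phi>) \<subseteq> D" "path_image (subpath t1 (t0+\<kappa>) \<phi>) \<subseteq> D"
    unfolding ims by (rule order_trans[OF image_mono D(4)]; use order \<kappa> in auto)+
  have away: "\<phi> ` {t1..t1+\<kappa>} \<inter> path_image (subpath (t0-\<kappa>) t2 \<phi>) = {}"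
    "\<phi> ` {t2-\<kappa>..t2} \<inter> path_image (subpath t1 (t0+\<kappa>) \<phi>) = {}"
    unfolding ims using order \<kappa> by (auto simp: eq)
  have dim: "2 \<le> DIM(complex)" by simp
  have pos: "0 \<le> t1" "0 \<le> t2 - \<kappa>" using order \<kappa> by auto
  obtain \<mu>1 where \<mu>1: "\<mu>1 > 0"
      "\<forall>Q\<subseteq>D. (\<forall>y\<in>Q. \<exists>x\<in>\<phi> ` {t0-\<kappa>..t2}. dist x y < \<mu>1) \<longrightarrow> \<phi> ` {t1..t1+\<kappa>} \<subseteq> outside Q"
    using outside_near_arc[OF arcs(1) dim D(2,3) imD(1) comp[OF pos(1)] away(1), unfolded ims] by blast
  obtain \<mu>2 where \<mu>2: "\<mu>2 > 0"
      "\<forall>Q\<subseteq>D. (\<forall>y\<in>Q. \<exists>x\<in>\<phi> ` {t1..t0+\<kappa>}. dist x y < \<mu>2) \<longrightarrow> \<phi> ` {t2-\<kappa>..t2} \<subseteq> outside Q"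
    using outside_near_arc[OF arcs(2) dim D(2,3) imD(2) comp[OF pos(2)] away(2), unfolded ims] by blast
  obtain \<rho> where "\<rho> > 0" "(\<Union>x\<in>\<phi> ` {t1..t2}. ball x \<rho>) \<subseteq> D"
    using compact_subset_open_imp_ball_epsilon_subset[OF comp(1)[OF order(1)] D(1,4)] .
  then have \<rho>: "\<rho> > 0" "\<And>x. x \<in> \<phi> ` {t1..t2} \<Longrightarrow> ball x \<rho> \<subseteq> D" by auto
  \<comment> \<open>The half of \<eta>0 leaves room for two errors of size \<eta>: one from the
    ball, one from the shadowing. \<mu>1 and \<mu>2 give the outside conditions, \<rho> containment
    in \<open>D\<close>, and \<epsilon> the use of \<open>H1\<close> and \<open>H2\<close>.\<close>
  define \<eta> where "\<eta> = Min {\<eta>0 / 2, \<mu>1, \<mu>2, \<rho>, \<epsilon>}"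
  have \<eta>: "\<eta> > 0" "2 * \<eta> \<le> \<eta>0" "\<eta> \<le> \<mu>1" "\<eta> \<le> \<mu>2" "\<eta> \<le> \<rho>" "\<eta> \<le> \<epsilon>"
    using \<eta>0 \<mu>1 \<mu>2 \<rho> \<open>\<epsilon> > 0\<close> by (auto simp: \<eta>_def)
  \<comment> \<open>The bound \<open>t2 + 1\<close> puts the return after the first strand, so
    injectivity makes the strands disjoint.\<close>
  obtain T where T: "T \<ge> t2 + 1" "\<And>s. s \<in> {0..t2} \<Longrightarrow> dist (\<phi> (T + s)) (\<phi> s) < \<eta>"
    using rec[OF \<eta>(1), of "t2 + 1" t2] by blast
  let ?A = "\<phi> ` {t1..t2}" and ?B = "\<phi> ` {T+t1..T+t2}"
  have AB: "?A \<inter> ?B = {}" using T order by (auto simp: eq)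
  have clos: "closed ?A" "closed ?B" using comp order T by (auto intro!: compact_imp_closed)
  \<comment> \<open>The segment from \<open>\<phi> r\<close> to its shadow may cross the strands
    repeatedly; it is shortened to a piece touching them only at its ends, whose times stay within
    \<kappa> of \<open>r\<close> and \<open>T + r\<close>.\<close>
  have trim: "\<exists>u v. u \<in> {t1..t2} \<and> v \<in> {t1..t2} \<and> \<bar>u - r\<bar> < \<kappa> \<and> \<bar>v - r\<bar> < \<kappa> \<and>
      closed_segment (\<phi> u) (\<phi> (T + v)) \<subseteq> ball (\<phi> r) \<eta> \<and>
      closed_segment (\<phi> u) (\<phi> (T + v)) \<inter> (?A \<union> ?B) = {\<phi> u, \<phi> (T + v)}"
    if r: "r \<in> {t1..t2}" for r
  proof -
    obtain p q where pq: "p \<in> ?A" "q \<in> ?B" "closed_segment p q \<subseteq> closed_segment (\<phi> r) (\<phi> (T + r))"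
      "closed_segment p q \<inter> (?A \<union> ?B) = {p, q}"
      using segment_between_disjoint_closed[OF clos AB, of "\<phi> r" "\<phi> (T + r)"] r
      by (metis add_left_mono atLeastAtMost_iff imageI)
    have ball: "closed_segment p q \<subseteq> ball (\<phi> r) \<eta>"
      using pq(3) T(2)[of r] r order \<eta>
        closed_segment_subset[of "\<phi> r" "ball (\<phi> r) \<eta>" "\<phi> (T + r)"] by (auto simp: dist_commute)
    obtain u where u: "u \<in> {t1..t2}" "p = \<phi> u" using pq by blast
    obtain w where w: "w \<in> {T+t1..T+t2}" "q = \<phi> w" using pq by blast
    define v where "v = w - T"
    have v: "v \<in> {t1..t2}" "q = \<phi> (T + v)" using w by (auto simp: v_def)
    have "dist (\<phi> u) (\<phi> r) < \<eta>0" using ball u \<eta> by (auto simp: dist_commute)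
    moreover have "dist (\<phi> v) (\<phi> r) < \<eta>0"
    proof -
      have "dist (\<phi> (T + v)) (\<phi> r) < \<eta>" using ball v by (auto simp: dist_commute)
      moreover have "dist (\<phi> (T + v)) (\<phi> v) < \<eta>" using T(2)[of v] v order by auto
      ultimately show ?thesis using dist_triangle3[of "\<phi> v" "\<phi> r" "\<phi> (T + v)"] \<eta> by linarith
    qed
    ultimately show ?thesis using \<eta>0(2) u v r ball pq(4) by blast
  qed
  obtain a1 c1 where 1: "a1 \<in> {t1..t2}" "c1 \<in> {t1..t2}" "\<bar>a1 - t1\<bar> < \<kappa>" "\<bar>c1 - t1\<bar> < \<kappa>"
      "closed_segment (\<phi> a1) (\<phi> (T + c1)) \<subseteq> ball (\<phi> t1) \<eta>"
      "closed_segment (\<phi> a1) (\<phi> (T + c1)) \<inter> (?A \<union> ?B) = {\<phi> a1, \<phi> (T + c1)}"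
    using trim[of t1] order by auto
  obtain a0 c0 where 0: "a0 \<in> {t1..t2}" "c0 \<in> {t1..t2}" "\<bar>a0 - t0\<bar> < \<kappa>" "\<bar>c0 - t0\<bar> < \<kappa>"
      "closed_segment (\<phi> a0) (\<phi> (T + c0)) \<subseteq> ball (\<phi> t0) \<eta>"
      "closed_segment (\<phi> a0) (\<phi> (T + c0)) \<inter> (?A \<union> ?B) = {\<phi> a0, \<phi> (T + c0)}"
    using trim[of t0] order by auto
  obtain a2 c2 where 2: "a2 \<in> {t1..t2}" "c2 \<in> {t1..t2}" "\<bar>a2 - t2\<bar> < \<kappa>" "\<bar>c2 - t2\<bar> < \<kappa>"
      "closed_segment (\<phi> a2) (\<phi> (T + c2)) \<subseteq> ball (\<phi> t2) \<eta>"
      "closed_segment (\<phi> a2) (\<phi> (T + c2)) \<inter> (?A \<union> ?B) = {\<phi> a2, \<phi> (T + c2)}"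
    using trim[of t2] order by auto
  have balls: "ball (\<phi> r) \<eta> \<inter> ball (\<phi> r') \<eta> = {}"
    if "r \<in> {t1..t2}" "r' \<in> {t1..t2}" "\<kappa> \<le> \<bar>r - r'\<bar>" for r r'
  proof (rule ccontr)
    assume "\<not> ?thesis"
    then obtain x where "dist (\<phi> r) x < \<eta>" "dist (\<phi> r') x < \<eta>" by auto
    then have "dist (\<phi> r) (\<phi> r') < \<eta>0" using dist_triangle2[of "\<phi> r" "\<phi> r'" x] \<eta> by linarith
    then show False using \<eta>0(2) that by fastforce
  qed
  have ballD: "ball (\<phi> r) \<eta> \<subseteq> D" if "r \<in> {t1..t2}" for r
    using \<rho>(2)[of "\<phi> r"] that \<eta>(5) by (meson imageI order_trans subset_ball)
  have near: "\<exists>x\<in>\<phi> ` {u..v}. dist x (\<phi> t) < \<eta>" if "t \<in> {T+u..T+v}" "0 \<le> u" "v \<le> t2" for t u v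
    using T(2)[of "t - T"] that by (intro bexI[of _ "\<phi> (t - T)"]) (auto simp: dist_commute)
  have BD: "?B \<subseteq> D"
  proof
    fix y assume "y \<in> ?B"
    then obtain x where "x \<in> ?A" "dist x y < \<eta>" using near order by blast
    then show "y \<in> D" using \<rho>(2)[of x] \<eta> by fastforce
  qed
  have restrict: "L \<inter> (\<phi> ` {a1..a2} \<union> \<phi> ` {T+c1..T+c2}) = {\<phi> u, \<phi> (T + v)}"
    if "L \<inter> (?A \<union> ?B) = {\<phi> u, \<phi> (T + v)}" "u \<in> {a1..a2}" "v \<in> {c1..c2}" for L u v
  proof -
    have "\<phi> ` {a1..a2} \<subseteq> ?A" "\<phi> ` {T+c1..T+c2} \<subseteq> ?B" using 1 2 by auto
    moreover have "\<phi> u \<in> \<phi> ` {a1..a2}" "\<phi> (T + v) \<in> \<phi> ` {T+c1..T+c2}" using that by auto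
    ultimately show ?thesis using that(1) by blast
  qed
  interpret strip \<phi> a1 a0 a2 "T + c1" "T + c0" "T + c2" D
  proof
    show "closed_segment (\<phi> a1) (\<phi> (T + c1)) \<inter> (\<phi> ` {a1..a2} \<union> \<phi> ` {T+c1..T+c2}) = {\<phi> a1, \<phi> (T + c1)}"
      by (rule restrict[OF 1(6)]) (use 1 2 \<kappa> order in auto)
    show "closed_segment (\<phi> a0) (\<phi> (T + c0)) \<inter> (\<phi> ` {a1..a2} \<union> \<phi> ` {T+c1..T+c2}) = {\<phi> a0, \<phi> (T + c0)}"
      by (rule restrict[OF 0(6)]) (use 0 1 2 \<kappa> order in auto)
    show "closed_segment (\<phi> a2) (\<phi> (T + c2)) \<inter> (\<phi> ` {a1..a2} \<union> \<phi> ` {T+c1..T+c2}) = {\<phi> a2, \<phi> (T + c2)}"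
      by (rule restrict[OF 2(6)]) (use 1 2 \<kappa> order in auto)
    have "ball (\<phi> t1) \<eta> \<inter> ball (\<phi> t0) \<eta> = {}" "ball (\<phi> t1) \<eta> \<inter> ball (\<phi> t2) \<eta> = {}"
      "ball (\<phi> t0) \<eta> \<inter> ball (\<phi> t2) \<eta> = {}"
      by (rule balls; use order \<kappa> in auto)+
    then show disj: "closed_segment (\<phi> a1) (\<phi> (T + c1)) \<inter> closed_segment (\<phi> a0) (\<phi> (T + c0)) = {}"
      "closed_segment (\<phi> a1) (\<phi> (T + c1)) \<inter> closed_segment (\<phi> a2) (\<phi> (T + c2)) = {}"
      "closed_segment (\<phi> a0) (\<phi> (T + c0)) \<inter> closed_segment (\<phi> a2) (\<phi> (T + c2)) = {}"
      using disjoint_mono[OF 1(5) 0(5)] disjoint_mono[OF 1(5) 2(5)] disjoint_mono[OF 0(5) 2(5)] by auto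
    show "\<phi> ` {a1..a2} \<subseteq> D" using D(4) 1 2 by (auto simp: image_subset_iff)
    show "\<phi> ` {T+c1..T+c2} \<subseteq> D" using BD 1 2 by (auto simp: image_subset_iff)
    have "\<phi> ` {t1..t1+\<kappa>} \<subseteq> outside (\<phi> ` {a0..a2} \<union> closed_segment (\<phi> a2) (\<phi> (T + c2)) \<union> \<phi> ` {T+c0..T+c2}
                 \<union> closed_segment (\<phi> a0) (\<phi> (T + c0)))" (is "_ \<subseteq> outside ?Q")
    proof (rule \<mu>1(2)[rule_format])
      have *: "\<phi> ` {a0..a2} \<subseteq> ?A" "\<phi> ` {T+c0..T+c2} \<subseteq> ?B" using 0 2 by auto
      have "ball (\<phi> t0) \<eta> \<subseteq> D" "ball (\<phi> t2) \<eta> \<subseteq> D" using ballD order by auto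
      then show "?Q \<subseteq> D"
        using order_trans[OF *(1) D(4)] order_trans[OF *(2) BD] order_trans[OF 0(5)] order_trans[OF 2(5)]
        by (intro Un_least)
      fix y assume "y \<in> ?Q"
      then consider "y \<in> \<phi> ` {a0..a2}" | "y \<in> ball (\<phi> t2) \<eta>" | "y \<in> ball (\<phi> t0) \<eta>"
        | "y \<in> \<phi> ` {T+c0..T+c2}" using 0(5) 2(5) by blast
      then have "\<exists>x\<in>\<phi> ` {t0-\<kappa>..t2}. dist x y < \<eta>"
      proof cases
        case first: 1
        then show ?thesis using 0 2 \<eta> by (intro bexI[of _ y]) auto
      next
        case second: 2
        then show ?thesis using order \<kappa> by (intro bexI[of _ "\<phi> t2"]) auto
      next
        case 3
        then show ?thesis using order \<kappa> by (intro bexI[of _ "\<phi> t0"]) auto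
      next
        case 4
        then obtain t where "t \<in> {T+c0..T+c2}" "y = \<phi> t" by blast
        then show ?thesis using near[of t "t0-\<kappa>" t2] 0 2 order \<kappa> by auto
      qed
      then show "\<exists>x\<in>\<phi> ` {t0-\<kappa>..t2}. dist x y < \<mu>1" using \<eta>(3) by force
    qed
    then show "\<phi> a1 \<in> outside ?Q" using 1 by auto
    have "\<phi> ` {t2-\<kappa>..t2} \<subseteq> outside (\<phi> ` {a1..a0} \<union> closed_segment (\<phi> a1) (\<phi> (T + c1)) \<union> \<phi> ` {T+c1..T+c0}
                 \<union> closed_segment (\<phi> a0) (\<phi> (T + c0)))" (is "_ \<subseteq> outside ?R")
    proof (rule \<mu>2(2)[rule_format])
      have *: "\<phi> ` {a1..a0} \<subseteq> ?A" "\<phi> ` {T+c1..T+c0} \<subseteq> ?B" using 0 1 by auto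
      have "ball (\<phi> t0) \<eta> \<subseteq> D" "ball (\<phi> t1) \<eta> \<subseteq> D" using ballD order by auto
      then show "?R \<subseteq> D"
        using order_trans[OF *(1) D(4)] order_trans[OF *(2) BD] order_trans[OF 0(5)] order_trans[OF 1(5)]
        by (intro Un_least)
      fix y assume "y \<in> ?R"
      then consider "y \<in> \<phi> ` {a1..a0}" | "y \<in> ball (\<phi> t1) \<eta>" | "y \<in> ball (\<phi> t0) \<eta>"
        | "y \<in> \<phi> ` {T+c1..T+c0}" using 0(5) 1(5) by blast
      then have "\<exists>x\<in>\<phi> ` {t1..t0+\<kappa>}. dist x y < \<eta>"
      proof cases
        case first: 1
        then show ?thesis using 0 1 \<eta> by (intro bexI[of _ y]) auto
      next
        case second: 2
        then show ?thesis using order \<kappa> by (intro bexI[of _ "\<phi> t1"]) auto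
      next
        case 3
        then show ?thesis using order \<kappa> by (intro bexI[of _ "\<phi> t0"]) auto
      next
        case 4
        then obtain t where "t \<in> {T+c1..T+c0}" "y = \<phi> t" by blast
        then show ?thesis using near[of t t1 "t0+\<kappa>"] 0 1 order \<kappa> by auto
      qed
      then show "\<exists>x\<in>\<phi> ` {t1..t0+\<kappa>}. dist x y < \<mu>2" using \<eta>(4) by force
    qed
    then have "\<phi> a2 \<in> outside ?R" using 2 by auto
    \<comment> \<open>The outside condition, obtained at \<open>\<phi> a2\<close>, is carried to the
      other strand along the last segment.\<close>
    moreover have "connected_component (- ?R) (\<phi> a2) (\<phi> (T + c2))"
    proof -
      have "\<phi> ` {a1..a0} \<subseteq> ?A" "\<phi> ` {T+c1..T+c0} \<subseteq> ?B" using 0 1 by auto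
      moreover have "\<phi> a2 \<notin> \<phi> ` {a1..a0} \<union> \<phi> ` {T+c1..T+c0}"
        "\<phi> (T + c2) \<notin> \<phi> ` {a1..a0} \<union> \<phi> ` {T+c1..T+c0}"
        using 0 1 2 \<kappa> order T by (auto simp: eq)
      ultimately have "closed_segment (\<phi> a2) (\<phi> (T + c2)) \<inter> (\<phi> ` {a1..a0} \<union> \<phi> ` {T+c1..T+c0}) = {}"
        by (intro disjoint_off_two_points[OF 2(6)] Un_mono) auto
      then have "closed_segment (\<phi> a2) (\<phi> (T + c2)) \<subseteq> - ?R" using disj(2,3) by auto
      then show ?thesis unfolding connected_component_def by (intro exI) auto
    qed
    ultimately show "\<phi> (T + c2) \<in> outside ?R" using outside_same_component by blast
  qed (use cont inj D 0 1 2 order \<kappa> T in auto)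
  show False
  proof (rule no_double_transit)
    show "\<exists>t\<ge>M. dist (\<phi> t) (\<phi> a1) < e" if e: "e > 0" for e M
    proof -
      obtain T where "T \<ge> M" "\<forall>s\<in>{0..a1}. dist (\<phi> (T + s)) (\<phi> s) < e" using rec[OF e] by blast
      then show ?thesis using 1 order by (intro exI[of _ "T + a1"]) auto
    qed
    show False if "0 \<le> s" "s \<le> t" "\<phi> ` {s..t} \<subseteq> D" "\<phi> s \<in> closed_segment (\<phi> a2) (\<phi> (T + c2))"
      "\<phi> t \<in> closed_segment (\<phi> a0) (\<phi> (T + c0))" for s t
      by (rule H1[of s t]) (use that 0(5) 2(5) \<eta> in \<open>auto simp: dist_commute\<close>)
    show False if "0 \<le> s" "s \<le> t" "\<phi> ` {s..t} \<subseteq> D" "\<phi> s \<in> closed_segment (\<phi> a0) (\<phi> (T + c0))"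
      "\<phi> t \<in> closed_segment (\<phi> a1) (\<phi> (T + c1))" for s t
      by (rule H2[of s t]) (use that 0(5) 1(5) \<eta> in \<open>auto simp: dist_commute\<close>)
  qed
qed

subsection \<open>Recurrent injective rays in the plane\<close>

text \<open>The time sought is the last one at distance at least \<open>r\<close>; the distance is
  then exactly \<open>r\<close> by continuity.\<close>

lemma last_exit:
  fixes \<phi> :: "real \<Rightarrow> 'a::metric_space"
  assumes "continuous_on {u..v} \<phi>" "u \<le> v" "r \<le> dist x (\<phi> u)" "dist x (\<phi> v) < r"
  obtains s where "u \<le> s" "s < v" "dist x (\<phi> s) = r" "\<phi> ` {s..v} \<subseteq> cball x r"
proof -
  define K where "K = {t \<in> {u..v}. \<phi> t \<in> - ball x r}"
  have "closed ({u..v} \<inter> \<phi> -` (- ball x r))"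
    by (rule continuous_closed_preimage) (use assms in auto)
  then have "closed K" unfolding K_def vimage_def Int_def by simp
  moreover have "bdd_above K" "u \<in> K" using assms by (auto simp: K_def)
  ultimately have "Sup K \<in> K" using closed_contains_Sup by blast
  define s where "s = Sup K"
  have s: "u \<le> s" "s \<le> v" "r \<le> dist x (\<phi> s)" using \<open>Sup K \<in> K\<close> by (auto simp: s_def K_def)
  then have sv: "s < v" using assms by (cases "s = v") auto
  have "\<phi> t \<in> cball x r" if "t \<in> {s<..v}" for t
  proof (rule ccontr)
    assume "\<phi> t \<notin> cball x r"
    then have "t \<in> K" using that s by (auto simp: K_def)
    then show False using cSup_upper[OF _ \<open>bdd_above K\<close>, of t] that by (simp add: s_def)
  qed
  then have "\<phi> ` closure {s<..v} \<subseteq> cball x r"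
    using sv s by (intro image_closure_subset continuous_on_subset[OF assms(1)])
      (auto simp: closure_greaterThanAtMost)
  then have "\<phi> ` {s..v} \<subseteq> cball x r" using sv by (simp add: closure_greaterThanAtMost)
  then show ?thesis using that[OF s(1) sv] s sv by force
qed

theorem plane_two_way_passage:
  fixes \<phi> :: "real \<Rightarrow> complex"
  assumes cont: "continuous_on {0..} \<phi>" and inj: "inj_on \<phi> {0..}"
    and rec: "\<And>N e M. e > 0 \<Longrightarrow> \<exists>S\<ge>M. \<forall>s\<in>{0..N}. dist (\<phi> (S + s)) (\<phi> s) < e"
    and "\<delta> > 0" "T \<ge> 0"
  shows "\<exists>y. y \<noteq> \<phi> T \<and> (\<forall>\<epsilon>>0. \<exists>t1 t2 t3 t4. 0 \<le> t1 \<and> t1 \<le> t2 \<and> 0 \<le> t3 \<and> t3 \<le> t4 \<and>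
      dist (\<phi> t1) (\<phi> T) < \<epsilon> \<and> dist (\<phi> t2) y < \<epsilon> \<and> dist (\<phi> t3) y < \<epsilon> \<and> dist (\<phi> t4) (\<phi> T) < \<epsilon> \<and>
      \<phi> ` {t1..t2} \<subseteq> ball (\<phi> T) \<delta> \<and> \<phi> ` {t3..t4} \<subseteq> ball (\<phi> T) \<delta>)"
proof (rule ccontr)
  define P where "P y \<epsilon> \<longleftrightarrow> (\<exists>t1 t2 t3 t4. 0 \<le> t1 \<and> t1 \<le> t2 \<and> 0 \<le> t3 \<and> t3 \<le> t4 \<and>
      dist (\<phi> t1) (\<phi> T) < \<epsilon> \<and> dist (\<phi> t2) y < \<epsilon> \<and> dist (\<phi> t3) y < \<epsilon> \<and> dist (\<phi> t4) (\<phi> T) < \<epsilon> \<and>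
      \<phi> ` {t1..t2} \<subseteq> ball (\<phi> T) \<delta> \<and> \<phi> ` {t3..t4} \<subseteq> ball (\<phi> T) \<delta>)" for y \<epsilon>
  assume "\<not> ?thesis"
  then have neg: "\<not> (\<exists>y. y \<noteq> \<phi> T \<and> (\<forall>\<epsilon>>0. P y \<epsilon>))" unfolding P_def .
  let ?x = "\<phi> T" and ?D = "ball (\<phi> T) \<delta>"
  have "\<exists>d>0. \<forall>t\<in>{0..}. dist t T < d \<longrightarrow> dist (\<phi> t) ?x < \<delta> / 2"
    using cont[unfolded continuous_on_iff, rule_format, of T "\<delta> / 2"] \<open>\<delta> > 0\<close> \<open>T \<ge> 0\<close> by auto
  then obtain d where d: "d > 0" "\<And>t. 0 \<le> t \<Longrightarrow> dist t T < d \<Longrightarrow> dist (\<phi> t) ?x < \<delta> / 2" by auto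
  \<comment> \<open>A short piece of the curve after \<open>T\<close> stays within half the allowed
    radius; its end \<open>y\<close> is the first candidate for the second point.\<close>
  define \<beta> where "\<beta> = d / 2"
  have \<beta>: "\<beta> > 0" "\<And>t. t \<in> {T..T+\<beta>} \<Longrightarrow> dist (\<phi> t) ?x < \<delta> / 2"
    using d \<open>T \<ge> 0\<close> by (auto simp: \<beta>_def dist_real_def)
  define y where "y = \<phi> (T + \<beta>)"
  have "y \<noteq> ?x" using inj_onD[OF inj, of "T + \<beta>" T] \<beta>(1) \<open>T \<ge> 0\<close> by (auto simp: y_def)
  \<comment> \<open>Small enough that the closed disc lies in \<open>?D\<close> and \<open>y\<close>
    lies off it, so each return to \<open>?x\<close> has to enter the disc after time
    \<open>T + \<beta>\<close>.\<close>
  define r where "r = min (\<delta> / 4) (dist ?x y / 2)"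
  have r: "r > 0" "r < \<delta> / 2" "r < dist ?x y" using \<open>\<delta> > 0\<close> \<open>y \<noteq> ?x\<close> by (auto simp: r_def min_def)
  have "\<exists>S. S \<ge> \<beta> + 1 \<and> (\<forall>s\<in>{0..T+\<beta>}. dist (\<phi> (S + s)) (\<phi> s) < min r (inverse (Suc n)))" for n
    using rec[of "min r (inverse (Suc n))" "\<beta> + 1" "T + \<beta>"] r by auto
  then obtain S where S: "\<And>n. S n \<ge> \<beta> + 1"
    "\<And>n s. s \<in> {0..T+\<beta>} \<Longrightarrow> dist (\<phi> (S n + s)) (\<phi> s) < min r (inverse (Suc n))"
    by metis
  have "\<exists>s. T + \<beta> \<le> s \<and> s < S n + T \<and> dist ?x (\<phi> s) = r \<and> \<phi> ` {s..S n + T} \<subseteq> cball ?x r" for n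
  proof (rule last_exit[of "T + \<beta>" "S n + T" \<phi> r ?x])
    show "continuous_on {T + \<beta>..S n + T} \<phi>"
      using \<beta>(1) \<open>T \<ge> 0\<close> by (auto intro: continuous_on_subset[OF cont])
    show "dist ?x (\<phi> (S n + T)) < r" using S(2)[of T n] \<open>T \<ge> 0\<close> \<beta>(1) by (auto simp: dist_commute)
  qed (use S(1)[of n] r in \<open>auto simp: y_def\<close>)
  then obtain \<sigma> where \<sigma>: "\<And>n. T + \<beta> \<le> \<sigma> n" "\<And>n. \<sigma> n < S n + T" "\<And>n. dist ?x (\<phi> (\<sigma> n)) = r"
    "\<And>n. \<phi> ` {\<sigma> n..S n + T} \<subseteq> cball ?x r" by metis
  have cball_D: "cball ?x r \<subseteq> ?D" using r \<open>\<delta> > 0\<close> by auto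
  have "\<forall>n. \<phi> (\<sigma> n) \<in> sphere ?x r" using \<sigma>(3) by simp
  then obtain e \<rho> where e: "e \<in> sphere ?x r" "strict_mono \<rho>" "(\<lambda>n. \<phi> (\<sigma> (\<rho> n))) \<longlonglongrightarrow> e"
    using compact_sphere[of ?x r, unfolded compact_def, rule_format, of "\<lambda>n. \<phi> (\<sigma> n)"]
    unfolding o_def by blast
  have "e \<noteq> ?x" using e(1) r by auto
  have near_e: "\<forall>\<^sub>F n in sequentially. dist (\<phi> (\<sigma> (\<rho> n))) e < \<epsilon>" if "\<epsilon> > 0" for \<epsilon>
    using tendstoD[OF e(3) that] .
  have near: "\<forall>\<^sub>F n in sequentially. \<forall>s\<in>{0..T+\<beta>}. dist (\<phi> (S (\<rho> n) + s)) (\<phi> s) < \<epsilon>" if "\<epsilon> > 0" for \<epsilon>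
  proof -
    have "\<forall>\<^sub>F n in sequentially. inverse (real (Suc n)) < \<epsilon>"
      using LIMSEQ_inverse_real_of_nat that by (rule order_tendstoD(2))
    then have "\<forall>\<^sub>F n in sequentially. inverse (real (Suc (\<rho> n))) < \<epsilon>"
      by (rule eventually_subseq[OF e(2)])
    then show ?thesis
    proof (rule eventually_mono, intro ballI)
      fix m s assume "inverse (real (Suc (\<rho> m))) < \<epsilon>" "s \<in> {0..T+\<beta>}"
      then show "dist (\<phi> (S (\<rho> m) + s)) (\<phi> s) < \<epsilon>" using S(2)[of s "\<rho> m"] by linarith
    qed
  qed
  obtain \<epsilon>1 where \<epsilon>1: "\<epsilon>1 > 0" "\<not> P y \<epsilon>1" using neg \<open>y \<noteq> ?x\<close> by blast
  obtain \<epsilon>2 where \<epsilon>2: "\<epsilon>2 > 0" "\<not> P e \<epsilon>2" using neg \<open>e \<noteq> ?x\<close> by blast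
  have P: "P z \<epsilon>" if "0 \<le> u1" "u1 \<le> u2" "0 \<le> u3" "u3 \<le> u4" "dist (\<phi> u1) ?x < \<epsilon>" "dist (\<phi> u2) z < \<epsilon>"
    "dist (\<phi> u3) z < \<epsilon>" "dist (\<phi> u4) ?x < \<epsilon>" "\<phi> ` {u1..u2} \<subseteq> ?D" "\<phi> ` {u3..u4} \<subseteq> ?D" for u1 u2 u3 u4 z \<epsilon>
    unfolding P_def using that by (intro exI conjI) assumption+
  \<comment> \<open>The halves absorb one more approximation: near \<open>\<phi> t1\<close>,
    \<open>\<phi> t0\<close> or \<open>\<phi> t2\<close> instead of near \<open>e\<close>,
    \<open>?x\<close> or \<open>y\<close>, and \<delta>/2 + \<epsilon> instead of \<delta>.\<close>
  define \<epsilon> where "\<epsilon> = min (min \<epsilon>1 \<epsilon>2) \<delta> / 2"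
  have \<epsilon>: "\<epsilon> > 0" "2 * \<epsilon> \<le> \<epsilon>1" "2 * \<epsilon> \<le> \<epsilon>2" "2 * \<epsilon> \<le> \<delta>"
    using \<epsilon>1(1) \<epsilon>2(1) \<open>\<delta> > 0\<close> by (auto simp: \<epsilon>_def)
  obtain n where n: "dist (\<phi> (\<sigma> (\<rho> n))) e < \<epsilon>"
    "\<And>s. s \<in> {0..T+\<beta>} \<Longrightarrow> dist (\<phi> (S (\<rho> n) + s)) (\<phi> s) < \<epsilon>"
    using eventually_happens'[OF _ eventually_conj[OF near_e[OF \<epsilon>(1)] near[OF \<epsilon>(1)]]] by auto
  define t1 t0 t2 where "t1 = \<sigma> (\<rho> n)" and "t0 = S (\<rho> n) + T" and "t2 = t0 + \<beta>"
  have t1: "0 \<le> t1" "t1 < t0" "dist (\<phi> t1) e < \<epsilon>" "\<phi> ` {t1..t0} \<subseteq> ?D"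
    using \<sigma>[of "\<rho> n"] n(1) cball_D \<beta>(1) \<open>T \<ge> 0\<close> unfolding t1_def t0_def by auto
  have t0: "dist (\<phi> t0) ?x < \<epsilon>" using n(2)[of T] \<beta>(1) \<open>T \<ge> 0\<close> by (simp add: t0_def)
  have t2: "dist (\<phi> t2) y < \<epsilon>" using n(2)[of "T + \<beta>"] \<beta>(1) \<open>T \<ge> 0\<close> by (simp add: t0_def t2_def y_def add.assoc)
  have "\<phi> t \<in> ?D" if "t \<in> {t0..t2}" for t
  proof -
    have "dist (\<phi> t) (\<phi> (t - S (\<rho> n))) < \<epsilon>" using n(2)[of "t - S (\<rho> n)"] that \<open>T \<ge> 0\<close> by (simp add: t0_def t2_def)
    moreover have "dist (\<phi> (t - S (\<rho> n))) ?x < \<delta> / 2" using \<beta>(2) that by (simp add: t0_def t2_def)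
    ultimately show ?thesis using dist_triangle[of "\<phi> t" ?x "\<phi> (t - S (\<rho> n))"] \<epsilon>(4) by (simp add: dist_commute)
  qed
  then have "\<phi> ` {t1..t2} \<subseteq> ?D"
    using t1(2,4) \<beta>(1) by (auto simp: image_subset_iff)
  show False
  proof (rule no_one_way_passage[OF cont inj rec t1(1,2), of t2 ?D \<epsilon>])
    show "t0 < t2" using \<beta>(1) by (simp add: t2_def)
    show "?D \<noteq> UNIV" using bounded_ball[of ?x \<delta>] not_bounded_UNIV by metis
    show "\<phi> ` {t1..t2} \<subseteq> ?D" by fact
    \<comment> \<open>With the piece from \<open>T\<close> to \<open>T + \<beta>\<close> as the way
      out, such a way back would make \<open>y\<close> succeed at \<epsilon>1.\<close>
    show False if "0 \<le> s" "s \<le> t" "\<phi> ` {s..t} \<subseteq> ?D" "dist (\<phi> s) (\<phi> t2) < \<epsilon>" "dist (\<phi> t) (\<phi> t0) < \<epsilon>" for s t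
    proof (rule \<epsilon>1(2)[THEN notE], rule P[of T "T + \<beta>" s t])
      show "dist (\<phi> s) y < \<epsilon>1" using dist_triangle[of "\<phi> s" y "\<phi> t2"] that t2 \<epsilon> by linarith
      show "dist (\<phi> t) ?x < \<epsilon>1" using dist_triangle[of "\<phi> t" ?x "\<phi> t0"] that t0 \<epsilon> by linarith
      show "\<phi> ` {T..T + \<beta>} \<subseteq> ?D" using \<beta>(2) \<open>\<delta> > 0\<close> by (fastforce simp: dist_commute)
    qed (use that \<epsilon>1(1) \<beta>(1) \<open>T \<ge> 0\<close> in \<open>auto simp: y_def\<close>)
    \<comment> \<open>With the piece from \<open>t1\<close> to \<open>t0\<close> as the way back,
      such a way out would make \<open>e\<close> succeed at \<epsilon>2.\<close>
    show False if "0 \<le> s" "s \<le> t" "\<phi> ` {s..t} \<subseteq> ?D" "dist (\<phi> s) (\<phi> t0) < \<epsilon>" "dist (\<phi> t) (\<phi> t1) < \<epsilon>" for s t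
    proof (rule \<epsilon>2(2)[THEN notE], rule P[of s t t1 t0])
      show "dist (\<phi> s) ?x < \<epsilon>2" using dist_triangle[of "\<phi> s" ?x "\<phi> t0"] that t0 \<epsilon> by linarith
      show "dist (\<phi> t) e < \<epsilon>2" using dist_triangle[of "\<phi> t" e "\<phi> t1"] that t1 \<epsilon> by linarith
    qed (use that t1 t0 \<epsilon> in auto)
  qed (use \<epsilon>(1) in auto)
qed

subsection \<open>Transfer to the sphere\<close>

text \<open>The chord of an angle \<open>t\<close> has length
  \<open>2 * sin (t / 2)\<close>.\<close>

lemma dist_le_sdist:
  assumes "x \<in> S2" "y \<in> S2"
  shows "dist x y \<le> sdist x y"
proof -
  have n: "norm x = 1" "norm y = 1" using assms by (simp_all add: S2_def)
  then have b: "-1 \<le> x \<bullet> y" "x \<bullet> y \<le> 1"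
    using Cauchy_Schwarz_ineq2[of x y] by auto
  define t where "t = sdist x y"
  have t: "0 \<le> t" "cos t = x \<bullet> y" using b by (auto simp: t_def sdist_def arccos_lbound)
  have "(dist x y)\<^sup>2 = 2 - 2 * (x \<bullet> y)"
    using n by (simp add: dist_norm power2_norm_eq_inner inner_diff inner_commute norm_eq_1)
  also have "\<dots> = (2 * sin (t / 2))\<^sup>2"
    using cos_double_sin[of "t / 2"] t by (simp add: power_mult_distrib)
  also have "\<dots> \<le> t\<^sup>2"
    using abs_sin_x_le_abs_x[of "t / 2"] by (subst abs_le_square_iff[symmetric]) (simp add: abs_mult)
  finally show ?thesis using power2_le_imp_le[OF _ t(1)] by (simp add: t_def)
qed

lemma sdist_less_of_dist:
  assumes "e > 0"
  obtains \<eta> where "\<eta> > 0" "\<And>x y. \<lbrakk>x \<in> S2; y \<in> S2; dist x y < \<eta>\<rbrakk> \<Longrightarrow> sdist x y < e"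
proof -
  \<comment> \<open>The angle is capped at \<open>pi\<close>, the range on which \<open>cos\<close>
    is decreasing; \<open>sqrt (2 - 2 * cos c)\<close> is the chord of the angle
    \<open>c\<close>.\<close>
  define c where "c = min e pi"
  have c: "0 < c" "c \<le> pi" "c \<le> e" using assms by (auto simp: c_def)
  have "cos c < cos 0" using c cos_monotone_0_pi[of 0 c] by simp
  then have pos: "0 < sqrt (2 - 2 * cos c)" by simp
  moreover have "sdist x y < e" if "x \<in> S2" "y \<in> S2" "dist x y < sqrt (2 - 2 * cos c)" for x y
  proof -
    have n: "norm x = 1" "norm y = 1" using that by (simp_all add: S2_def)
    then have b: "x \<bullet> y \<le> 1" using Cauchy_Schwarz_ineq2[of x y] by auto
    have "(dist x y)\<^sup>2 = 2 - 2 * (x \<bullet> y)"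
      using n by (simp add: dist_norm power2_norm_eq_inner inner_diff inner_commute norm_eq_1)
    moreover have "(dist x y)\<^sup>2 < (sqrt (2 - 2 * cos c))\<^sup>2"
      using that(3) by (intro power_strict_mono) auto
    ultimately have "cos c < x \<bullet> y" using \<open>cos c < cos 0\<close> by simp
    then have "arccos (x \<bullet> y) < arccos (cos c)" using b by (intro arccos_less_arccos) auto
    then show ?thesis using c by (simp add: sdist_def arccos_cos)
  qed
  ultimately show ?thesis using that by blast
qed

lemma punctured_S2_homeomorphic_plane:
  assumes "b \<in> S2"
  obtains g k where "homeomorphism (S2 - {b}) (UNIV :: complex set) g k"
proof -
  have "aff_dim (UNIV :: complex set) + 1 = aff_dim (UNIV :: (real^3) set)" by simp
  then have "(sphere 0 1 \<inter> (UNIV :: (real^3) set)) - {b} homeomorphic (UNIV :: complex set)"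
    by (intro homeomorphic_punctured_affine_sphere_affine) (use assms in \<open>auto simp: S2_def\<close>)
  then show ?thesis using that by (auto simp: S2_def homeomorphic_def)
qed

text \<open>Otherwise the plane, as a punctured sphere, would be the union of the closed sets
  \<open>A n\<close>. By invariance of dimension none of them has interior, since
  \<open>\<phi>\<close> is a homeomorphism from an interval onto each compact piece; this
  contradicts the Baire property.\<close>

lemma injective_ray_misses_point:
  fixes \<phi> :: "real \<Rightarrow> real^3"
  assumes cont: "continuous_on {0..} \<phi>" and inj: "inj_on \<phi> {0..}"
  shows "\<exists>b\<in>S2. b \<notin> \<phi> ` {0..}"
proof (rule ccontr)
  assume "\<not> ?thesis"
  then have cover: "S2 \<subseteq> \<phi> ` {0..}" by blast
  have "axis 1 1 \<in> S2" by (simp add: S2_def)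
  then obtain b where b: "b \<in> S2" by blast
  obtain g k where gk: "homeomorphism (S2 - {b}) (UNIV :: complex set) g k"
    using punctured_S2_homeomorphic_plane[OF b] .
  have k: "continuous_on UNIV k" "inj k" "range k = S2 - {b}"
    using gk by (auto simp: homeomorphism_def inj_on_def) metis
  define A where "A n = k -` (\<phi> ` {0..real n})" for n :: nat
  have comp: "compact (\<phi> ` {0..real n})" for n
    by (intro compact_continuous_image continuous_on_subset[OF cont]) auto
  have closed: "closed (A n)" for n
    using continuous_closed_vimage compact_imp_closed[OF comp[of n]] k(1)
    by (auto simp: A_def continuous_on_eq_continuous_within)
  have empty: "interior (A n) = {}" for n
  proof (rule ccontr)
    assume ne: "interior (A n) \<noteq> {}"
    let ?f = "\<lambda>z. the_inv_into {0..real n} \<phi> (k z)"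
    have injn: "inj_on \<phi> {0..real n}" using inj by (rule inj_on_subset) auto
    have cinv: "continuous_on (\<phi> ` {0..real n}) (the_inv_into {0..real n} \<phi>)"
      by (rule continuous_on_inv)
        (auto intro: continuous_on_subset[OF cont] simp: the_inv_into_f_f[OF injn])
    have "continuous_on (interior (A n)) ?f"
    proof (rule continuous_on_compose2[OF cinv])
      show "k ` interior (A n) \<subseteq> \<phi> ` {0..real n}" using interior_subset[of "A n"] by (auto simp: A_def)
    qed (auto intro: continuous_on_subset[OF k(1)])
    moreover have "inj_on ?f (interior (A n))"
    proof (rule inj_onI)
      fix z w assume "z \<in> interior (A n)" "w \<in> interior (A n)" "?f z = ?f w"
      moreover have "k z \<in> \<phi> ` {0..real n}" "k w \<in> \<phi> ` {0..real n}"
        using calculation interior_subset[of "A n"] by (auto simp: A_def)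
      ultimately have "k z = k w" using f_the_inv_into_f[OF injn] by metis
      then show "z = w" using k(2) by (simp add: inj_eq)
    qed
    ultimately have "DIM(complex) \<le> DIM(real)"
      using invariance_of_dimension[of "interior (A n)" ?f] ne by blast
    then show False by simp
  qed
  have "(UNIV :: complex set) \<subseteq> closure (\<Inter>n. - A n)"
  proof (rule Baire)
    fix U assume "U \<in> range (\<lambda>n. - A n)"
    then show "openin (top_of_set UNIV) U \<and> UNIV \<subseteq> closure U"
      using closed empty by (auto simp: closure_complement)
  qed auto
  moreover have "(\<Inter>n. - A n) = {}"
  proof -
    have "\<exists>n. z \<in> A n" for z
    proof -
      have "k z \<in> \<phi> ` {0..}" using cover k(3) by blast
      then obtain t where "t \<ge> 0" "k z = \<phi> t" by auto
      then have "z \<in> A (nat \<lceil>t\<rceil>)" by (auto simp: A_def intro!: imageI)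
      then show ?thesis by blast
    qed
    then show ?thesis by blast
  qed
  ultimately show False by simp
qed

text \<open>\<open>g\<close> need not be uniformly continuous near the puncture \<open>b\<close>,
  but a point close to \<open>C\<close> stays away from \<open>b\<close>, so the compact set left
  after removing a ball around \<open>b\<close> is enough.\<close>

lemma uniform_modulus_near_compact:
  fixes g :: "'a::euclidean_space \<Rightarrow> 'b::metric_space"
  assumes "compact S" "continuous_on (S - {b}) g" "compact C" "C \<subseteq> S - {b}" "e > 0"
  obtains \<eta> where "\<eta> > 0"
    "\<And>x y. \<lbrakk>x \<in> C; y \<in> S - {b}; dist y x < \<eta>\<rbrakk> \<Longrightarrow> dist (g y) (g x) < e"
proof -
  have "open (- {b})" by auto
  then obtain r where r: "r > 0" "(\<Union>x\<in>C. cball x r) \<subseteq> - {b}"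
    using compact_subset_open_imp_cball_epsilon_subset[OF assms(3), of "- {b}"] assms(4) by blast
  define \<rho> where "\<rho> = r / 2"
  have "r < dist x b" if "x \<in> C" for x using r(2) that by (force simp: not_less)
  then have \<rho>: "\<rho> > 0" "\<And>x. x \<in> C \<Longrightarrow> 2 * \<rho> \<le> dist x b"
    using r(1) by (force simp: \<rho>_def)+
  let ?K = "S - ball b \<rho>"
  have "compact ?K" using assms(1) by (simp add: compact_diff)
  moreover have sub: "?K \<subseteq> S - {b}" using \<rho> by auto
  ultimately have "uniformly_continuous_on ?K g"
    using assms(2) by (intro compact_uniformly_continuous) (auto intro: continuous_on_subset)
  then obtain d where d: "d > 0" "\<And>x y. \<lbrakk>x \<in> ?K; y \<in> ?K; dist y x < d\<rbrakk> \<Longrightarrow> dist (g y) (g x) < e"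
    using assms(5) unfolding uniformly_continuous_on_def by metis
  have "dist (g y) (g x) < e" if "x \<in> C" "y \<in> S - {b}" "dist y x < min d \<rho>" for x y
  proof (rule d(2))
    have "2 * \<rho> \<le> dist x b" using \<rho> that by blast
    then show "x \<in> ?K" "y \<in> ?K" using that assms(4) \<rho>(1) dist_triangle3[of x b y]
      by (auto simp: dist_commute)
  qed (use that in auto)
  then show ?thesis using that[of "min d \<rho>"] d(1) \<rho>(1) by auto
qed

theorem theorem2p8:
  fixes \<phi> :: "real \<Rightarrow> real^3"
  assumes cont: "continuous_on {0..} \<phi>"
    and inj: "inj_on \<phi> {0..}"
    and sph: "\<phi> ` {0..} \<subseteq> S2"
    and acc: "\<exists>tn :: nat \<Rightarrow> real. filterlim tn at_top sequentially \<and>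
               (\<forall>K. compact K \<and> K \<subseteq> {0..} \<longrightarrow>
                  (\<forall>e>0. eventually (\<lambda>n. \<forall>s\<in>K. sdist (shift (tn n) \<phi> s) (\<phi> s) < e) sequentially))"
    and delta: "\<delta> > 0"
    and T: "T \<ge> 0"
  shows "\<exists>x1 x2. x1 \<in> S2 \<and> x2 \<in> S2 \<and> x1 \<noteq> x2 \<and> x1 = \<phi> T \<and>
           (\<forall>\<epsilon>>0. \<exists>t1 t2 t3 t4. 0 \<le> t1 \<and> t1 \<le> t2 \<and> 0 \<le> t3 \<and> t3 \<le> t4 \<and>
              sdist (\<phi> t1) x1 < \<epsilon> \<and> sdist (\<phi> t2) x2 < \<epsilon> \<and>
              sdist (\<phi> t3) x2 < \<epsilon> \<and> sdist (\<phi> t4) x1 < \<epsilon> \<and>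
              (\<forall>t \<in> {t1..t2} \<union> {t3..t4}. sdist (\<phi> t) x1 < \<delta>))"
proof -
  obtain b where b: "b \<in> S2" "b \<notin> \<phi> ` {0..}" using injective_ray_misses_point[OF cont inj] by blast
  obtain g k where gk: "homeomorphism (S2 - {b}) (UNIV :: complex set) g k"
    using punctured_S2_homeomorphic_plane[OF b(1)] .
  have g: "continuous_on (S2 - {b}) g" and kg: "\<And>x. x \<in> S2 - {b} \<Longrightarrow> k (g x) = x"
    and k: "continuous_on UNIV k" "\<And>z. g (k z) = z" "\<And>z. k z \<in> S2 - {b}"
    using gk by (auto simp: homeomorphism_def)
  have \<phi>: "\<phi> t \<in> S2 - {b}" if "0 \<le> t" for t using sph b that by (auto simp: image_subset_iff)
  define \<psi> where "\<psi> t = g (\<phi> t)" for t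
  have k\<psi>: "k (\<psi> t) = \<phi> t" if "0 \<le> t" for t using kg \<phi> that by (simp add: \<psi>_def)
  have cont': "continuous_on {0..} \<psi>"
    unfolding \<psi>_def by (rule continuous_on_compose2[OF g cont]) (use \<phi> in auto)
  have inj': "inj_on \<psi> {0..}"
    by (rule inj_onI) (metis k\<psi> inj_onD[OF inj] atLeast_iff)
  \<comment> \<open>Recurrence passes to the plane: the angle bounds the chord, and the modulus of
    \<open>g\<close> is taken near the compact piece of the curve on \<open>{0..N}\<close>.\<close>
  have rec: "\<exists>S\<ge>M. \<forall>s\<in>{0..N}. dist (\<psi> (S + s)) (\<psi> s) < e" if "e > 0" for N e M
  proof -
    have "compact (\<phi> ` {0..N})"
      by (intro compact_continuous_image continuous_on_subset[OF cont]) auto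
    moreover have "compact S2" by (simp add: S2_def)
    moreover have "\<phi> ` {0..N} \<subseteq> S2 - {b}" by (rule image_subsetI) (rule \<phi>, simp)
    ultimately obtain \<eta> where \<eta>: "\<eta> > 0"
      "\<And>x y. \<lbrakk>x \<in> \<phi> ` {0..N}; y \<in> S2 - {b}; dist y x < \<eta>\<rbrakk> \<Longrightarrow> dist (g y) (g x) < e"
      using uniform_modulus_near_compact[of S2 b g "\<phi> ` {0..N}" e] g \<open>e > 0\<close> by metis
    obtain tn :: "nat \<Rightarrow> real" where tn: "filterlim tn at_top sequentially"
      "\<forall>K. compact K \<and> K \<subseteq> {0..} \<longrightarrow>
        (\<forall>e>0. \<forall>\<^sub>F n in sequentially. \<forall>s\<in>K. sdist (shift (tn n) \<phi> s) (\<phi> s) < e)"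
      using acc by (elim exE conjE) (rule that)
    have "\<forall>\<^sub>F n in sequentially. \<forall>s\<in>{0..N}. sdist (shift (tn n) \<phi> s) (\<phi> s) < \<eta>"
      using tn(2)[rule_format, of "{0..N}" \<eta>] \<eta>(1) by auto
    moreover have "\<forall>\<^sub>F n in sequentially. tn n \<ge> max M 0"
      using tn(1) unfolding filterlim_at_top by blast
    ultimately have "\<forall>\<^sub>F n in sequentially. tn n \<ge> max M 0 \<and> (\<forall>s\<in>{0..N}. sdist (shift (tn n) \<phi> s) (\<phi> s) < \<eta>)"
      by eventually_elim simp
    then obtain n where n: "tn n \<ge> max M 0" "\<And>s. s \<in> {0..N} \<Longrightarrow> sdist (shift (tn n) \<phi> s) (\<phi> s) < \<eta>"
      using eventually_happens' sequentially_bot by blast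
    have "dist (\<psi> (tn n + s)) (\<psi> s) < e" if "s \<in> {0..N}" for s
      unfolding \<psi>_def
    proof (rule \<eta>(2))
      show "\<phi> (tn n + s) \<in> S2 - {b}" using n(1) that by (intro \<phi>) auto
      then show "dist (\<phi> (tn n + s)) (\<phi> s) < \<eta>"
        using dist_le_sdist[of "\<phi> (tn n + s)" "\<phi> s"] \<phi>[of s] that n(2)[OF that] by (simp add: shift_def)
    qed (use that in auto)
    then show ?thesis using n(1) by (intro exI[of _ "tn n"]) auto
  qed
  \<comment> \<open>Continuity of \<open>k\<close> at \<open>w\<close> turns closeness in the plane
    into closeness in angle; the second point on the sphere will be \<open>k w\<close>.\<close>
  have pull: "\<exists>d>0. \<forall>t\<ge>0. dist (\<psi> t) w < d \<longrightarrow> sdist (\<phi> t) (k w) < e" if e: "e > 0" for e w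
  proof -
    obtain \<eta> where \<eta>: "\<eta> > 0" "\<And>x y. \<lbrakk>x \<in> S2; y \<in> S2; dist x y < \<eta>\<rbrakk> \<Longrightarrow> sdist x y < e"
      using sdist_less_of_dist[OF e] by metis
    obtain d where d: "d > 0" "\<And>z. dist z w < d \<Longrightarrow> dist (k z) (k w) < \<eta>"
      using k(1) \<eta>(1) unfolding continuous_on_iff by blast
    have "sdist (\<phi> t) (k w) < e" if "t \<ge> 0" "dist (\<psi> t) w < d" for t
      using \<eta>(2)[of "\<phi> t" "k w"] d(2)[OF that(2)] k\<psi>[OF that(1)] \<phi>[OF that(1)] k(3)[of w] by simp
    then show ?thesis using d(1) by blast
  qed
  obtain d where d: "d > 0" "\<And>t. \<lbrakk>t \<ge> 0; dist (\<psi> t) (\<psi> T) < d\<rbrakk> \<Longrightarrow> sdist (\<phi> t) (\<phi> T) < \<delta>"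
    using pull[OF delta, of "\<psi> T"] k\<psi>[OF T] by auto
  obtain w where w: "w \<noteq> \<psi> T" "\<And>\<epsilon>. \<epsilon> > 0 \<Longrightarrow> \<exists>t1 t2 t3 t4. 0 \<le> t1 \<and> t1 \<le> t2 \<and> 0 \<le> t3 \<and> t3 \<le> t4 \<and>
      dist (\<psi> t1) (\<psi> T) < \<epsilon> \<and> dist (\<psi> t2) w < \<epsilon> \<and> dist (\<psi> t3) w < \<epsilon> \<and> dist (\<psi> t4) (\<psi> T) < \<epsilon> \<and>
      \<psi> ` {t1..t2} \<subseteq> ball (\<psi> T) d \<and> \<psi> ` {t3..t4} \<subseteq> ball (\<psi> T) d"
    using plane_two_way_passage[OF cont' inj' rec d(1) T] by auto
  show ?thesis
  proof (rule exI[of _ "\<phi> T"], rule exI[of _ "k w"], intro conjI allI impI)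
    show "\<phi> T \<in> S2" "k w \<in> S2" using \<phi>[OF T] k(3)[of w] by auto
    show "\<phi> T \<noteq> k w" using w(1) k(2)[of w] by (auto simp: \<psi>_def)
    fix \<epsilon> :: real assume "\<epsilon> > 0"
    obtain e1 where e1: "e1 > 0" "\<And>t. \<lbrakk>t \<ge> 0; dist (\<psi> t) (\<psi> T) < e1\<rbrakk> \<Longrightarrow> sdist (\<phi> t) (\<phi> T) < \<epsilon>"
      using pull[OF \<open>\<epsilon> > 0\<close>, of "\<psi> T"] k\<psi>[OF T] by auto
    obtain e2 where e2: "e2 > 0" "\<And>t. \<lbrakk>t \<ge> 0; dist (\<psi> t) w < e2\<rbrakk> \<Longrightarrow> sdist (\<phi> t) (k w) < \<epsilon>"
      using pull[OF \<open>\<epsilon> > 0\<close>, of w] by auto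
    obtain t1 t2 t3 t4 where t: "0 \<le> t1" "t1 \<le> t2" "0 \<le> t3" "t3 \<le> t4"
      "dist (\<psi> t1) (\<psi> T) < min e1 e2" "dist (\<psi> t2) w < min e1 e2"
      "dist (\<psi> t3) w < min e1 e2" "dist (\<psi> t4) (\<psi> T) < min e1 e2"
      "\<psi> ` {t1..t2} \<subseteq> ball (\<psi> T) d" "\<psi> ` {t3..t4} \<subseteq> ball (\<psi> T) d"
      using w(2)[of "min e1 e2"] e1(1) e2(1) by auto
    have "sdist (\<phi> s) (\<phi> T) < \<delta>" if "s \<in> {t1..t2} \<union> {t3..t4}" for s
    proof (rule d(2))
      show "0 \<le> s" using that t by auto
      have "\<psi> s \<in> ball (\<psi> T) d" using that t(9,10) by blast
      then show "dist (\<psi> s) (\<psi> T) < d" by (simp add: dist_commute)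
    qed
    then show "\<exists>t1 t2 t3 t4. 0 \<le> t1 \<and> t1 \<le> t2 \<and> 0 \<le> t3 \<and> t3 \<le> t4 \<and>
              sdist (\<phi> t1) (\<phi> T) < \<epsilon> \<and> sdist (\<phi> t2) (k w) < \<epsilon> \<and>
              sdist (\<phi> t3) (k w) < \<epsilon> \<and> sdist (\<phi> t4) (\<phi> T) < \<epsilon> \<and>
              (\<forall>t \<in> {t1..t2} \<union> {t3..t4}. sdist (\<phi> t) (\<phi> T) < \<delta>)"
      using t(1-4) e1(2)[of t1] e2(2)[of t2] e2(2)[of t3] e1(2)[of t4] t(5-8)
      by (intro exI[of _ t1] exI[of _ t2] exI[of _ t3] exI[of _ t4] conjI ballI) simp_all
  qed simp
qed

end
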